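(* Let $\vec p=(\infty,p_2)$ with $1<p_2<\infty$, and let $\vec a,\vec b,\vec c\in\mathbb{R}^2$, $\vec\alpha\in(-1,\infty)^2$. Then the following are equivalent: (1) $S_{\vec a,\vec b,\vec c}$ is bounded from $L^{\vec p}_{\vec\alpha}(T_B\times T_B)$ to $L^\infty(T_B\times T_B)$; (2) $T_{\vec a,\vec b,\vec c}$ is bounded from $L^{\vec p}_{\vec\alpha}(T_B\times T_B)$ to $L^\infty(T_B\times T_B)$; (3) $a_1>0$, $a_2>0$, $b_1>-1$, $p_2(b_2+1)>\alpha_2+1$, $c_1=n+1+a_1+b_1$, and $c_2=n+1+a_2+b_2-\frac{n+1+\alpha_2}{p_2}$.
   Context: Let $n$ be a positive integer. For $z=(z_1,\dots,z_n)\in\mathbb{C}^n$ write $z=x+iy$ with $x,y\in\mathbb{R}^n$, $z'=(z_1,\dots,z_{n-1})$, $y'=(y_1,\dots,y_{n-1})$. Let $B=\{y\in\mathbb{R}^n: |y'|^2<y_n\}$ and $T_B=\{x+iy: x\in\mathbb{R}^n, y\in B\}$. For $z\in T_B$ put $\rho(z)=y_n-|y'|^2>0$, and for $z,u\in T_B$ put $\rho(z,u)=\frac14\big(\sum_{j=1}^{n-1}(z_j-\overline{u_j})^2-2i(z_n-\overline{u_n})\big)$; this has positive real part, and complex powers $\rho(z,u)^c$ are taken with the principal branch. $dV$ is Lebesgue measure on $\mathbb{C}^n$ and $dV_\alpha(z)=\rho(z)^\alpha dV(z)$. For $\vec p=(p_1,p_2)\in[1,\infty]^2$ and $\vec\alpha=(\alpha_1,\alpha_2)$,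 $L^{\vec p}_{\vec\alpha}(T_B\times T_B)$ is the space of measurable $f$ on $T_B\times T_B$ with finite mixed norm $\|f\|_{\vec p,\vec\alpha}=\big\{\int_{T_B}\big(\int_{T_B}|f(z,w)|^{p_1}dV_{\alpha_1}(z)\big)^{p_2/p_1}dV_{\alpha_2}(w)\big\}^{1/p_2}$, with the inner (resp. outer) integral replaced by an essential supremum in $z$ (resp. $w$) when $p_1=\infty$ (resp. $p_2=\infty$); when $\vec p=(\infty,\infty)$ this is $L^\infty(T_B\times T_B)$. For $\vec a=(a_1,a_2),\vec b=(b_1,b_2),\vec c=(c_1,c_2)\in\mathbb{R}^2$, $T_{\vec a,\vec b,\vec c}f(z,w)=\rho(z)^{a_1}\rho(w)^{a_2}\int_{T_B}\int_{T_B}\frac{\rho(u)^{b_1}\rho(\eta)^{b_2}}{\rho(z,u)^{c_1}\rho(w,\eta)^{c_2}}f(u,\eta)\,dV(u)\,dV(\eta)$ and $S_{\vec a,\vec b,\vec c}f(z,w)=\rho(z)^{a_1}\rho(w)^{a_2}\int_{T_B}\int_{T_B}\frac{\rho(u)^{b_1}\rho(\eta)^{b_2}}{|\rho(z,u)|^{c_1}|\rho(w,\eta)|^{c_2}}f(u,\eta)\,dV(u)\,dV(\eta)$. An operator is bounded from $X$ to $Y$ if for every $f\in X$ the defining integral converges for a.e. $(z,w)$ and $\|Tf\|_Y\le C\|f\|_X$ with $C$ independent of $f$. *)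

theory Defs
  imports "HOL-Analysis.Analysis" "HOL-Probability.Essential_Supremum"
begin

text \<open>Points of C^n are represented as functions nat => complex on the index set
  {0..<n} (extensional elements of the product space); coordinate z_j of the paper is
  z (j-1), so z' = (z 0, ..., z (n-2)) and z_n = z (n-1).  Lebesgue measure dV on C^n is
  the product of the Lebesgue(-Borel) measures on the n copies of C.\<close>

definition Cn :: "nat \<Rightarrow> (nat \<Rightarrow> complex) measure" where
  "Cn n = PiM {..<n} (\<lambda>_. (lborel :: complex measure))"

definition rho :: "nat \<Rightarrow> (nat \<Rightarrow> complex) \<Rightarrow> real" where
  "rho n z = Im (z (n - 1)) - (\<Sum>j<n - 1. (Im (z j))\<^sup>2)"

definition TB :: "nat \<Rightarrow> (nat \<Rightarrow> complex) set" where
  "TB n = {z \<in> space (Cn n). rho n z > 0}"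

definition rho2 :: "nat \<Rightarrow> (nat \<Rightarrow> complex) \<Rightarrow> (nat \<Rightarrow> complex) \<Rightarrow> complex" where
  "rho2 n z u = (1/4) * ((\<Sum>j<n - 1. (z j - cnj (u j))\<^sup>2) - 2 * \<i> * (z (n - 1) - cnj (u (n - 1))))"

definition dV :: "nat \<Rightarrow> real \<Rightarrow> (nat \<Rightarrow> complex) measure" where
  "dV n \<alpha> = density (Cn n) (\<lambda>z. indicator (TB n) z * ennreal (rho n z powr \<alpha>))"

definition enn_powr :: "ennreal \<Rightarrow> real \<Rightarrow> ennreal" where
  "enn_powr x r = (if x = \<infinity> then \<infinity> else ennreal (enn2real x powr r))"

definition mixed_norm_inf_p :: "nat \<Rightarrow> real \<Rightarrow> real \<Rightarrow> real \<Rightarrow>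
    ((nat \<Rightarrow> complex) \<times> (nat \<Rightarrow> complex) \<Rightarrow> complex) \<Rightarrow> ennreal" where
  "mixed_norm_inf_p n p2 \<alpha>1 \<alpha>2 f =
     enn_powr (\<integral>\<^sup>+ w. enn_powr (esssup (dV n \<alpha>1) (\<lambda>z. ennreal (cmod (f (z, w))))) p2 \<partial>dV n \<alpha>2)
       (1 / p2)"

text \<open>Mixed norm for p = (\<infinity>,\<infinity>), i.e. the L^\<infinity>(T_B \<times> T_B) norm (weights are irrelevant).\<close>
definition mixed_norm_inf_inf :: "nat \<Rightarrow>
    ((nat \<Rightarrow> complex) \<times> (nat \<Rightarrow> complex) \<Rightarrow> complex) \<Rightarrow> ennreal" where
  "mixed_norm_inf_inf n f =
     esssup (dV n 0) (\<lambda>w. esssup (dV n 0) (\<lambda>z. ennreal (cmod (f (z, w)))))"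

definition kerT :: "nat \<Rightarrow> real \<Rightarrow> real \<Rightarrow> real \<Rightarrow> real \<Rightarrow>
    (nat \<Rightarrow> complex) \<Rightarrow> (nat \<Rightarrow> complex) \<Rightarrow> (nat \<Rightarrow> complex) \<Rightarrow> (nat \<Rightarrow> complex) \<Rightarrow> complex" where
  "kerT n b1 b2 c1 c2 z w u \<eta> =
     complex_of_real (rho n u powr b1 * rho n \<eta> powr b2) /
       (rho2 n z u powr complex_of_real c1 * rho2 n w \<eta> powr complex_of_real c2)"

definition kerS :: "nat \<Rightarrow> real \<Rightarrow> real \<Rightarrow> real \<Rightarrow> real \<Rightarrow>
    (nat \<Rightarrow> complex) \<Rightarrow> (nat \<Rightarrow> complex) \<Rightarrow> (nat \<Rightarrow> complex) \<Rightarrow> (nat \<Rightarrow> complex) \<Rightarrow> complex" where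
  "kerS n b1 b2 c1 c2 z w u \<eta> =
     complex_of_real (rho n u powr b1 * rho n \<eta> powr b2 /
       (cmod (rho2 n z u) powr c1 * cmod (rho2 n w \<eta>) powr c2))"

definition op_int :: "nat \<Rightarrow> real \<Rightarrow> real \<Rightarrow>
    ((nat \<Rightarrow> complex) \<Rightarrow> (nat \<Rightarrow> complex) \<Rightarrow> (nat \<Rightarrow> complex) \<Rightarrow> (nat \<Rightarrow> complex) \<Rightarrow> complex) \<Rightarrow>
    ((nat \<Rightarrow> complex) \<times> (nat \<Rightarrow> complex) \<Rightarrow> complex) \<Rightarrow>
    ((nat \<Rightarrow> complex) \<times> (nat \<Rightarrow> complex) \<Rightarrow> complex)" where
  "op_int n a1 a2 K f = (\<lambda>(z, w). complex_of_real (rho n z powr a1 * rho n w powr a2) *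
      (\<integral> (u, \<eta>). K z w u \<eta> * f (u, \<eta>) \<partial>(dV n 0 \<Otimes>\<^sub>M dV n 0)))"

definition bounded_inf_p_to_inf :: "nat \<Rightarrow> real \<Rightarrow> real \<Rightarrow> real \<Rightarrow> real \<Rightarrow> real \<Rightarrow>
    ((nat \<Rightarrow> complex) \<Rightarrow> (nat \<Rightarrow> complex) \<Rightarrow> (nat \<Rightarrow> complex) \<Rightarrow> (nat \<Rightarrow> complex) \<Rightarrow> complex) \<Rightarrow> bool" where
  "bounded_inf_p_to_inf n p2 \<alpha>1 \<alpha>2 a1 a2 K \<longleftrightarrow>
     (\<exists>C::real. C \<ge> 0 \<and>
       (\<forall>f \<in> borel_measurable (Cn n \<Otimes>\<^sub>M Cn n).
          mixed_norm_inf_p n p2 \<alpha>1 \<alpha>2 f < \<infinity> \<longrightarrow>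
            (AE x in dV n 0 \<Otimes>\<^sub>M dV n 0.
               integrable (dV n 0 \<Otimes>\<^sub>M dV n 0) (\<lambda>(u, \<eta>). K (fst x) (snd x) u \<eta> * f (u, \<eta>))) \<and>
            mixed_norm_inf_inf n (op_int n a1 a2 K f) \<le> ennreal C * mixed_norm_inf_p n p2 \<alpha>1 \<alpha>2 f))"

end

theory Submission
  imports Defs "HOL-Complex_Analysis.Cauchy_Integral_Theorem"
begin

text \<open>
  Since \<open>Re \<rho>(z,u) = (|z' - u'|\<^sup>2 / 2 + \<rho>(z) + \<rho>(u)) / 2\<close>, integrating out one real variable at a
  time gives, for all real \<open>b\<close> and \<open>c\<close>, the identity
  \<open>\<integral> \<rho>(u)\<^sup>b |\<rho>(z,u)|\<^sup>-\<^sup>c dV(u) = \<kappa> \<rho>(z)\<close> to the power \<open>n + 1 + b - c\<close>, where \<open>0 < \<kappa> \<le> \<infinity>\<close>, and \<open>\<kappa>\<close> is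
  finite exactly when \<open>b > -1\<close> and \<open>c > n + 1 + b\<close>. Hence \<open>\<rho>(z)\<^sup>a\<close> times this integral is bounded in
  \<open>z\<close> if and only if \<open>a > 0\<close>, \<open>b > -1\<close> and \<open>c = n + 1 + a + b\<close>.

  Sufficiency follows by estimating \<open>f(u,\<eta>)\<close> by its essential supremum in \<open>u\<close> and applying Young's
  inequality in \<open>\<eta>\<close>. For necessity, fix a point \<open>(z\<^sub>0,w\<^sub>0)\<close> and test with \<open>f(u,\<eta>) = \<phi>(u,\<eta>) g(\<eta>)\<close>,
  where \<open>\<phi>\<close> is the conjugate phase of the kernel at \<open>(z\<^sub>0,w\<^sub>0)\<close>. The kernel at \<open>(z,w)\<close> is close to the
  kernel at \<open>(z\<^sub>0,w\<^sub>0)\<close> in the sense of ratios, uniformly in \<open>(u,\<eta>)\<close>, so the almost everywhere bound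
  yields a bound for the positive kernel at \<open>(z\<^sub>0,w\<^sub>0)\<close> itself. With \<open>g\<close> running through
  truncations of the extremal function of Hoelder's inequality, both one-variable
  factors turn out to be integrals of the above kind.
\<close>

section \<open>Model integrals\<close>

lemma nn_integral_powr_atLeast_1:
  "(\<integral>\<^sup>+x. ennreal (x powr a) * indicator {1..} x \<partial>lborel) < \<infinity> \<longleftrightarrow> a < -1" for a :: real
proof (cases "a < -1")
  case True
  have "((\<lambda>x. x powr (a+1) / (a+1)) \<longlongrightarrow> 0 / (a+1)) at_top"
    using True by (intro tendsto_divide tendsto_neg_powr filterlim_ident tendsto_const) auto
  then have "(\<integral>\<^sup>+x. ennreal (x powr a) * indicator {1..} x \<partial>lborel) = ennreal (0 - 1 powr (a+1) / (a+1))"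
    using True
    by (intro nn_integral_FTC_atLeast[where F="\<lambda>x. x powr (a+1) / (a+1)"])
       (auto intro!: derivative_eq_intros)
  then show ?thesis using True by simp
next
  case False
  \<comment> \<open>For \<open>a \<ge> -1\<close> the integrand dominates \<open>1/x\<close> on
    [1,R], so the integral is at least \<open>ln R\<close> for every R. Taking
    \<open>R = exp k\<close> then exceeds every natural number k. The integral near 0 below is
    treated in the same way with \<open>exp (-k)\<close>.\<close>
  have "ennreal (ln R) \<le> (\<integral>\<^sup>+x. ennreal (x powr a) * indicator {1..} x \<partial>lborel)" if "R \<ge> 1" for R :: real
  proof -
    have "(\<integral>\<^sup>+x. ennreal (1/x) * indicator {1..R} x \<partial>lborel) = ennreal (ln R - ln 1)"
      using that by (intro nn_integral_FTC_Icc) (auto intro!: derivative_eq_intros)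
    moreover have "(\<integral>\<^sup>+x. ennreal (1/x) * indicator {1..R} x \<partial>lborel) \<le> (\<integral>\<^sup>+x. ennreal (x powr a) * indicator {1..} x \<partial>lborel)"
    proof (intro nn_integral_mono)
      fix x :: real
      have "1 / x \<le> x powr a" if "x \<ge> 1"
        using powr_mono[of "-1" a x] False that by (simp add: powr_minus_divide)
      then show "ennreal (1/x) * indicator {1..R} x \<le> ennreal (x powr a) * indicator {1..} x"
        by (auto simp: indicator_def intro: ennreal_leI)
    qed
    ultimately show ?thesis by simp
  qed
  from this[of "exp (real _)"] have "of_nat k \<le> (\<integral>\<^sup>+x. ennreal (x powr a) * indicator {1..} x \<partial>lborel)" for k :: nat
    by (simp add: ennreal_of_nat_eq_real_of_nat)
  then have "(\<integral>\<^sup>+x. ennreal (x powr a) * indicator {1..} x \<partial>lborel) = \<infinity>"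
    by (metis ennreal_Ex_less_of_nat infinity_ennreal_def leD top.not_eq_extremum)
  with False show ?thesis by simp
qed

lemma nn_integral_powr_0_1:
  "(\<integral>\<^sup>+x. ennreal (x powr a) * indicator {0<..1} x \<partial>lborel) < \<infinity> \<longleftrightarrow> a > -1" for a :: real
proof (cases "a > -1")
  case True
  have "(\<lambda>x. x powr a) integrable_on {0..1}"
    using True by (intro integrable_on_powr_from_0) auto
  then have "((\<lambda>x. x powr a) has_integral integral {0..1} (\<lambda>x. x powr a)) {0..1}"
    by (rule integrable_integral)
  from nn_integral_has_integral_lborel[OF _ _ has_integral_restrict_UNIV[THEN iffD2, OF this]]
  have "(\<integral>\<^sup>+x. ennreal (if x \<in> {0..1} then x powr a else 0) \<partial>lborel) = ennreal (integral {0..1} (\<lambda>x. x powr a))"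
    by auto
  moreover have "(\<integral>\<^sup>+x. ennreal (x powr a) * indicator {0<..1} x \<partial>lborel)
    \<le> (\<integral>\<^sup>+x. ennreal (if x \<in> {0..1} then x powr a else 0) \<partial>lborel)"
    by (intro nn_integral_mono) (auto simp: indicator_def)
  ultimately show ?thesis using True
    by (metis ennreal_less_top infinity_ennreal_def order.strict_trans1)
next
  case False
  have "ennreal (- ln e) \<le> (\<integral>\<^sup>+x. ennreal (x powr a) * indicator {0<..1} x \<partial>lborel)" if "e \<le> 1" "e > 0" for e :: real
  proof -
    have "(\<integral>\<^sup>+x. ennreal (1/x) * indicator {e..1} x \<partial>lborel) = ennreal (ln 1 - ln e)"
      using that by (intro nn_integral_FTC_Icc) (auto intro!: derivative_eq_intros)
    moreover have "(\<integral>\<^sup>+x. ennreal (1/x) * indicator {e..1} x \<partial>lborel) \<le> (\<integral>\<^sup>+x. ennreal (x powr a) * indicator {0<..1} x \<partial>lborel)"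
    proof (intro nn_integral_mono)
      fix x :: real
      have "1 / x \<le> x powr a" if "x \<le> 1" "x > 0"
        using powr_mono'[of a "-1" x] False that by (simp add: powr_minus_divide)
      then show "ennreal (1/x) * indicator {e..1} x \<le> ennreal (x powr a) * indicator {0<..1} x"
        using that by (auto simp: indicator_def intro: ennreal_leI)
    qed
    ultimately show ?thesis by simp
  qed
  from this[of "exp (- real _)"] have "of_nat k \<le> (\<integral>\<^sup>+x. ennreal (x powr a) * indicator {0<..1} x \<partial>lborel)" for k :: nat
    by (simp add: ennreal_of_nat_eq_real_of_nat)
  then have "(\<integral>\<^sup>+x. ennreal (x powr a) * indicator {0<..1} x \<partial>lborel) = \<infinity>"
    by (metis ennreal_Ex_less_of_nat infinity_ennreal_def leD top.not_eq_extremum)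
  with False show ?thesis by simp
qed

text \<open>Whether \<open>powr\<close> increases or decreases depends on the sign of
  \<open>s\<close>. The \<open>max\<close> and \<open>min\<close> with 1 cover both cases, so the
  comparisons below need no case split on the exponent.\<close>

lemma powr_between:
  fixes y :: real assumes "0 < x" "x \<le> y" "y \<le> K * x" "K \<ge> 1"
  shows "y powr s \<le> max 1 (K powr s) * x powr s"
    and "min 1 (K powr s) * x powr s \<le> y powr s"
proof -
  have "y powr s \<le> max 1 (K powr s) * x powr s \<and> min 1 (K powr s) * x powr s \<le> y powr s"
  proof (cases "s \<ge> 0")
    case True
    then have "x powr s \<le> y powr s" "y powr s \<le> (K * x) powr s"
      using assms by (auto intro!: powr_mono2)
    moreover have "min 1 (K powr s) * x powr s \<le> 1 * x powr s" "K powr s * x powr s \<le> max 1 (K powr s) * x powr s"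
      by (rule mult_right_mono; simp)+
    moreover have "(K * x) powr s = K powr s * x powr s"
      using assms by (simp add: powr_mult)
    ultimately show ?thesis by (metis mult_1 order_trans)
  next
    case False
    then have "y powr s \<le> x powr s" "(K * x) powr s \<le> y powr s"
      using assms by (auto intro!: powr_mono2')
    moreover have "1 * x powr s \<le> max 1 (K powr s) * x powr s" "min 1 (K powr s) * x powr s \<le> K powr s * x powr s"
      by (rule mult_right_mono; simp)+
    moreover have "(K * x) powr s = K powr s * x powr s"
      using assms by (simp add: powr_mult)
    ultimately show ?thesis by (metis mult_1 order_trans)
  qed
  then show "y powr s \<le> max 1 (K powr s) * x powr s" "min 1 (K powr s) * x powr s \<le> y powr s"
    by auto
qed

lemma nn_integral_less_top_iff_comparable:
  assumes [measurable]: "f \<in> borel_measurable M" "g \<in> borel_measurable M"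
    and "0 < (a::real)" "0 < (b::real)"
    and "\<And>x. x \<in> space M \<Longrightarrow> f x \<le> ennreal a * g x" "\<And>x. x \<in> space M \<Longrightarrow> g x \<le> ennreal b * f x"
  shows "(\<integral>\<^sup>+x. f x \<partial>M) < \<infinity> \<longleftrightarrow> (\<integral>\<^sup>+x. g x \<partial>M) < \<infinity>"
proof -
  have 1: "(\<integral>\<^sup>+x. f x \<partial>M) \<le> ennreal a * (\<integral>\<^sup>+x. g x \<partial>M)"
    using assms by (subst nn_integral_cmult[symmetric]) (auto intro!: nn_integral_mono)
  have 2: "(\<integral>\<^sup>+x. g x \<partial>M) \<le> ennreal b * (\<integral>\<^sup>+x. f x \<partial>M)"
    using assms by (subst nn_integral_cmult[symmetric]) (auto intro!: nn_integral_mono)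
  show ?thesis
    using order.strict_trans1[OF 1] order.strict_trans1[OF 2] by (auto simp: ennreal_mult_less_top)
qed

text \<open>When finite, this is the Beta value B(1/2, s - 1/2), and \<open>beta_const b d\<close>
  is B(b + 1, d - b - 1). Values are in \<open>ennreal\<close> so that the scaling identities hold
  for all real parameters; only positivity and the exact range of finiteness are ever used.\<close>

definition quad_const :: "real \<Rightarrow> ennreal" where
  "quad_const s = (\<integral>\<^sup>+x. ennreal ((1 + x\<^sup>2) powr (- s)) \<partial>lborel)"

definition beta_const :: "real \<Rightarrow> real \<Rightarrow> ennreal" where
  "beta_const b d = (\<integral>\<^sup>+y. indicator {0<..} y * ennreal (y powr b * (1 + y) powr (- d)) \<partial>lborel)"

text \<open>The middle piece over (-1,1) is always finite. The two tails agree by reflection, and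
  there the integrand is comparable to \<open>x powr (- 2 * s)\<close>.\<close>

lemma quad_const_finite: "quad_const s < \<infinity> \<longleftrightarrow> s > 1/2"
proof -
  define P where "P = (\<integral>\<^sup>+x. ennreal ((1 + x\<^sup>2) powr (- s)) * indicator {1..} x \<partial>lborel)"
  define Q where "Q = (\<integral>\<^sup>+x. ennreal ((1 + x\<^sup>2) powr (- s)) * indicator {-1<..<1::real} x \<partial>lborel)"
  have neg: "(\<integral>\<^sup>+x. ennreal ((1 + x\<^sup>2) powr (- s)) * indicator {..-1::real} x \<partial>lborel) = P"
    unfolding P_def
    by (subst nn_integral_real_affine[where c="-1" and t=0])
       (auto intro!: nn_integral_cong simp: indicator_def)
  have "quad_const s = (\<integral>\<^sup>+x. ennreal ((1 + x\<^sup>2) powr (- s)) * indicator {1..} x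
      + (ennreal ((1 + x\<^sup>2) powr (- s)) * indicator {-1<..<1::real} x
      + ennreal ((1 + x\<^sup>2) powr (- s)) * indicator {..-1::real} x) \<partial>lborel)"
    unfolding quad_const_def by (intro nn_integral_cong) (auto simp: indicator_def)
  also have "\<dots> = P + (Q + P)"
    by (subst nn_integral_add, simp, simp, subst nn_integral_add) (auto simp: neg P_def Q_def)
  finally have eq: "quad_const s = P + (Q + P)" .
  have "Q \<le> (\<integral>\<^sup>+x. ennreal (max 1 (2 powr (- s))) * indicator {-1<..<1::real} x \<partial>lborel)"
    unfolding Q_def
  proof (intro nn_integral_mono)
    fix x :: real
    show "ennreal ((1 + x\<^sup>2) powr (- s)) * indicator {-1<..<1::real} x
      \<le> ennreal (max 1 (2 powr (- s))) * indicator {-1<..<1::real} x"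
      using powr_between(1)[of 1 "1 + x\<^sup>2" 2 "-s"] abs_square_le_1[of x]
      by (auto simp: indicator_def intro!: ennreal_leI)
  qed
  also have "\<dots> < \<infinity>"
    by (simp add: nn_integral_cmult ennreal_mult_less_top)
  finally have Q: "Q < \<infinity>" .
  have "P < \<infinity> \<longleftrightarrow> (\<integral>\<^sup>+x. ennreal (x powr (- 2 * s)) * indicator {1..} x \<partial>lborel) < \<infinity>"
    unfolding P_def
  proof (rule nn_integral_less_top_iff_comparable[where a="max 1 (2 powr (- s))" and b="1 / min 1 (2 powr (- s))"])
    fix x :: real
    have "(x\<^sup>2) powr (- s) = x powr (- 2 * s)" if "x \<ge> 1"
      using that by (simp add: powr_powr flip: powr_numeral)
    moreover have "1 + x\<^sup>2 \<le> 2 * x\<^sup>2" if "x \<ge> 1"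
      using one_le_power[OF that, of 2] by simp
    ultimately have *: "x \<ge> 1 \<Longrightarrow> (1 + x\<^sup>2) powr (- s) \<le> max 1 (2 powr (- s)) * x powr (- 2 * s)"
        "x \<ge> 1 \<Longrightarrow> min 1 (2 powr (- s)) * x powr (- 2 * s) \<le> (1 + x\<^sup>2) powr (- s)"
      using powr_between[of "x\<^sup>2" "1 + x\<^sup>2" 2 "-s"] by auto
    show "ennreal ((1 + x\<^sup>2) powr (- s)) * indicator {1..} x \<le> ennreal (max 1 (2 powr (- s))) * (ennreal (x powr (- 2 * s)) * indicator {1..} x)"
      using *(1) by (auto simp: indicator_def ennreal_mult[symmetric] intro!: ennreal_leI)
    have "x \<ge> 1 \<Longrightarrow> x powr (- 2 * s) \<le> 1 / min 1 (2 powr (- s)) * (1 + x\<^sup>2) powr (- s)"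
      using *(2) by (subst times_divide_eq_left, subst pos_le_divide_eq) (auto simp: min_def mult_ac)
    then show "ennreal (x powr (- 2 * s)) * indicator {1..} x
        \<le> ennreal (1 / min 1 (2 powr (- s))) * (ennreal ((1 + x\<^sup>2) powr (- s)) * indicator {1..} x)"
      by (auto simp: indicator_def ennreal_mult[symmetric] intro!: ennreal_leI)
  qed (auto simp: min_def)
  then show ?thesis using Q nn_integral_powr_atLeast_1[of "- 2 * s"] by (simp add: eq mult.commute)
qed

text \<open>The integrand is comparable to \<open>y powr b\<close> on (0,1) and to
  \<open>y powr (b - d)\<close> on [1,\<infinity>). The two conditions are the convergence
  conditions at 0 and at infinity.\<close>

lemma beta_const_finite: "beta_const b d < \<infinity> \<longleftrightarrow> b > -1 \<and> d > b + 1"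
proof -
  define P where "P = (\<integral>\<^sup>+y. ennreal (y powr b * (1 + y) powr (- d)) * indicator {1..} y \<partial>lborel)"
  define Q where "Q = (\<integral>\<^sup>+y. ennreal (y powr b * (1 + y) powr (- d)) * indicator {0<..<1} y \<partial>lborel)"
  have eq: "beta_const b d = P + Q"
    unfolding P_def Q_def beta_const_def
    by (subst nn_integral_add[symmetric]) (auto intro!: nn_integral_cong simp: indicator_def)
  define A where "A = max 1 (2 powr (- d))"
  define B where "B = min 1 (2 powr (- d))"
  have A: "A > 0" and B: "B > 0" by (auto simp: A_def B_def)
  have "P < \<infinity> \<longleftrightarrow> (\<integral>\<^sup>+x. ennreal (x powr (b - d)) * indicator {1..} x \<partial>lborel) < \<infinity>"
    unfolding P_def
  proof (rule nn_integral_less_top_iff_comparable[where a=A and b="1 / B"])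
    fix y :: real
    have *: "y \<ge> 1 \<Longrightarrow> (1 + y) powr (- d) \<le> A * y powr (- d)"
        "y \<ge> 1 \<Longrightarrow> B * y powr (- d) \<le> (1 + y) powr (- d)"
      using powr_between[of y "1 + y" 2 "-d"] by (auto simp: A_def B_def)
    have **: "y powr (b - d) = y powr b * y powr (- d)"
      by (simp flip: powr_add)
    show "ennreal (y powr b * (1 + y) powr (- d)) * indicator {1..} y \<le> ennreal A * (ennreal (y powr (b - d)) * indicator {1..} y)"
      using *(1) mult_left_mono[OF *(1), of "y powr b"] A
      by (auto simp: indicator_def ennreal_mult[symmetric] ** mult_ac intro!: ennreal_leI)
    have "y \<ge> 1 \<Longrightarrow> y powr (b - d) \<le> 1 / B * (y powr b * (1 + y) powr (- d))"
      using *(2) mult_left_mono[OF *(2), of "y powr b"] B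
      by (subst times_divide_eq_left, subst pos_le_divide_eq) (auto simp: ** mult_ac)
    then show "ennreal (y powr (b - d)) * indicator {1..} y
        \<le> ennreal (1 / B) * (ennreal (y powr b * (1 + y) powr (- d)) * indicator {1..} y)"
      using B by (auto simp: indicator_def ennreal_mult[symmetric] intro!: ennreal_leI)
  qed (use A B in auto)
  moreover have "Q < \<infinity> \<longleftrightarrow> (\<integral>\<^sup>+x. ennreal (x powr b) * indicator {0<..<1} x \<partial>lborel) < \<infinity>"
    unfolding Q_def
  proof (rule nn_integral_less_top_iff_comparable[where a=A and b="1 / B"])
    fix y :: real
    have *: "y > 0 \<Longrightarrow> y < 1 \<Longrightarrow> (1 + y) powr (- d) \<le> A"
        "y > 0 \<Longrightarrow> y < 1 \<Longrightarrow> B \<le> (1 + y) powr (- d)"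
      using powr_between[of 1 "1 + y" 2 "-d"] by (auto simp: A_def B_def)
    show "ennreal (y powr b * (1 + y) powr (- d)) * indicator {0<..<1} y \<le> ennreal A * (ennreal (y powr b) * indicator {0<..<1} y)"
      using *(1) mult_left_mono[OF *(1), of "y powr b"] A
      by (auto simp: indicator_def ennreal_mult[symmetric] mult_ac intro!: ennreal_leI)
    have "y > 0 \<Longrightarrow> y < 1 \<Longrightarrow> y powr b \<le> 1 / B * (y powr b * (1 + y) powr (- d))"
      using *(2) mult_left_mono[OF *(2), of "y powr b"] B
      by (subst times_divide_eq_left, subst pos_le_divide_eq) (auto simp: mult_ac)
    then show "ennreal (y powr b) * indicator {0<..<1} y
        \<le> ennreal (1 / B) * (ennreal (y powr b * (1 + y) powr (- d)) * indicator {0<..<1} y)"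
      using B by (auto simp: indicator_def ennreal_mult[symmetric] intro!: ennreal_leI)
  qed (use A B in auto)
  moreover have "(\<integral>\<^sup>+x. ennreal (x powr b) * indicator {0<..<1} x \<partial>lborel)
      = (\<integral>\<^sup>+x. ennreal (x powr b) * indicator {0<..1} x \<partial>lborel)"
    using AE_lborel_singleton[of "1::real"]
    by (intro nn_integral_cong_AE) (auto elim!: eventually_mono simp: indicator_def)
  ultimately show ?thesis
    using nn_integral_powr_atLeast_1[of "b - d"] nn_integral_powr_0_1[of b] by (auto simp: eq)
qed

lemma quad_const_pos: "quad_const s > 0"
proof (rule ccontr)
  assume "\<not> quad_const s > 0"
  then have "AE x in lborel. ennreal ((1 + x\<^sup>2) powr (- s)) = 0"
    unfolding quad_const_def by (subst nn_integral_0_iff_AE[symmetric]) auto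
  then have "AE x::real in lborel. False"
    by (rule eventually_mono) (auto simp: add_nonneg_eq_0_iff dest: sym)
  then show False by (simp add: AE_iff_measurable[OF _ refl])
qed

lemma beta_const_pos: "beta_const b d > 0"
proof (rule ccontr)
  assume "\<not> beta_const b d > 0"
  then have "AE y in lborel. indicator {0<..} y * ennreal (y powr b * (1 + y) powr (- d)) = 0"
    unfolding beta_const_def by (subst nn_integral_0_iff_AE[symmetric]) auto
  then have "AE y::real in lborel. y \<notin> {0<..<1}"
    by (rule eventually_mono) (auto simp: indicator_def mult_le_0_iff split: if_splits)
  then have "emeasure lborel {0<..<1::real} = 0"
    by (subst (asm) AE_iff_measurable[where N="{0<..<1}"]) auto
  then show False by simp
qed

lemma nn_integral_shifted_quadratic_powr:
  fixes \<Delta> \<kappa> a s :: real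
  assumes "\<Delta> > 0" "\<kappa> > 0"
  shows "(\<integral>\<^sup>+x. ennreal ((\<Delta> + \<kappa> * (x - a)\<^sup>2) powr (- s)) \<partial>lborel)
    = ennreal (\<Delta> powr (1/2 - s)) * (ennreal (\<kappa> powr (-1/2)) * quad_const s)"
proof -
  \<comment> \<open>The substitution \<open>x = a + ?c * t\<close> turns \<Delta> + \<kappa> (x -
    a)^2 into \<Delta> (1 + t^2), so \<Delta> leaves the integral as a pure power.\<close>
  let ?c = "sqrt (\<Delta> / \<kappa>)"
  have c: "?c > 0" "?c\<^sup>2 = \<Delta> / \<kappa>" using assms by auto
  have "(\<integral>\<^sup>+x. ennreal ((\<Delta> + \<kappa> * (x - a)\<^sup>2) powr (- s)) \<partial>lborel)
     = ?c * (\<integral>\<^sup>+x. ennreal ((\<Delta> + \<kappa> * (a + ?c * x - a)\<^sup>2) powr (- s)) \<partial>lborel)"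
    using c(1) by (subst nn_integral_real_affine[where c="?c" and t=a]) auto
  also have "(\<lambda>x. ennreal ((\<Delta> + \<kappa> * (a + ?c * x - a)\<^sup>2) powr (- s)))
      = (\<lambda>x. ennreal (\<Delta> powr (- s)) * ennreal ((1 + x\<^sup>2) powr (- s)))"
  proof
    fix x
    have "\<Delta> + \<kappa> * (a + ?c * x - a)\<^sup>2 = \<Delta> + \<kappa> * (?c\<^sup>2 * x\<^sup>2)"
      by (simp add: power_mult_distrib del: real_sqrt_pow2_iff)
    also have "\<dots> = \<Delta> * (1 + x\<^sup>2)" unfolding c(2) using assms by (simp add: field_simps)
    finally show "ennreal ((\<Delta> + \<kappa> * (a + ?c * x - a)\<^sup>2) powr (- s)) = ennreal (\<Delta> powr (- s)) * ennreal ((1 + x\<^sup>2) powr (- s))"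
      using assms by (simp add: powr_mult ennreal_mult)
  qed
  also have "?c * (\<integral>\<^sup>+x. ennreal (\<Delta> powr (- s)) * ennreal ((1 + x\<^sup>2) powr (- s)) \<partial>lborel)
     = ennreal (?c * \<Delta> powr (- s)) * quad_const s"
    unfolding quad_const_def using c(1)
    by (subst nn_integral_cmult) (auto simp: ennreal_mult mult_ac)
  also have "?c * \<Delta> powr (- s) = \<Delta> powr (1/2 - s) * \<kappa> powr (-1/2)"
    using assms by (simp add: powr_half_sqrt[symmetric] powr_divide powr_minus_divide powr_diff)
  finally show ?thesis using assms by (simp add: ennreal_mult mult_ac)
qed

text \<open>The substitution is y = \<beta> + \<Delta> t. In the application \<beta> is |Im u'|^2,
  the lower end of the range of Im u_n in the tube.\<close>

lemma nn_integral_shifted_beta: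
  fixes \<Delta> \<beta> b d :: real
  assumes "\<Delta> > 0"
  shows "(\<integral>\<^sup>+y. indicator {\<beta><..} y * ennreal ((y - \<beta>) powr b * (\<Delta> + (y - \<beta>)) powr (- d)) \<partial>lborel)
    = ennreal (\<Delta> powr (1 + b - d)) * beta_const b d"
proof -
  have "(\<integral>\<^sup>+y. indicator {\<beta><..} y * ennreal ((y - \<beta>) powr b * (\<Delta> + (y - \<beta>)) powr (- d)) \<partial>lborel)
     = \<Delta> * (\<integral>\<^sup>+y. indicator {\<beta><..} (\<beta> + \<Delta> * y) * ennreal ((\<beta> + \<Delta> * y - \<beta>) powr b * (\<Delta> + (\<beta> + \<Delta> * y - \<beta>)) powr (- d)) \<partial>lborel)"
    using assms by (subst nn_integral_real_affine[where c=\<Delta> and t=\<beta>]) auto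
  also have "(\<lambda>y. indicator {\<beta><..} (\<beta> + \<Delta> * y) * ennreal ((\<beta> + \<Delta> * y - \<beta>) powr b * (\<Delta> + (\<beta> + \<Delta> * y - \<beta>)) powr (- d)))
     = (\<lambda>y. ennreal (\<Delta> powr (b - d)) * (indicator {0<..} y * ennreal (y powr b * (1 + y) powr (- d))))"
  proof
    fix y
    have *: "\<Delta> * y > 0 \<longleftrightarrow> y > 0" using assms by (simp add: zero_less_mult_iff)
    have "\<Delta> + \<Delta> * y = \<Delta> * (1 + y)" by (simp add: algebra_simps)
    then have "(\<Delta> * y) powr b * (\<Delta> + \<Delta> * y) powr (- d) = \<Delta> powr (b - d) * (y powr b * (1 + y) powr (- d))" if "y > 0"
      using that assms by (simp add: powr_mult powr_diff powr_minus_divide)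
    then show "indicator {\<beta><..} (\<beta> + \<Delta> * y) * ennreal ((\<beta> + \<Delta> * y - \<beta>) powr b * (\<Delta> + (\<beta> + \<Delta> * y - \<beta>)) powr (- d))
       = ennreal (\<Delta> powr (b - d)) * (indicator {0<..} y * ennreal (y powr b * (1 + y) powr (- d)))"
      by (auto simp: indicator_def * ennreal_mult[symmetric])
  qed
  also have "\<Delta> * (\<integral>\<^sup>+y. ennreal (\<Delta> powr (b - d)) * (indicator {0<..} y * ennreal (y powr b * (1 + y) powr (- d))) \<partial>lborel)
     = ennreal (\<Delta> powr (1 + b - d)) * beta_const b d"
    unfolding beta_const_def using assms
    by (subst nn_integral_cmult) (auto simp: ennreal_mult[symmetric] mult.assoc[symmetric] powr_add powr_diff)
  finally show ?thesis .
qed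

section \<open>Lebesgue measure on C and integration over several complex variables\<close>

lemma lborel_complex_eq_distr:
  "(lborel :: complex measure) = distr (lborel \<Otimes>\<^sub>M lborel) borel (\<lambda>(x, y). Complex x y)"
proof (rule lborel_eqI)
  have [measurable]: "(\<lambda>(x, y). Complex x y) \<in> borel_measurable (borel \<Otimes>\<^sub>M borel)"
    by (simp add: borel_prod) (intro borel_measurable_continuous_onI, auto simp: case_prod_unfold Complex_eq intro!: continuous_intros)
  fix l u :: complex assume le: "\<And>b. b \<in> Basis \<Longrightarrow> l \<bullet> b \<le> u \<bullet> b"
  have le': "Re l \<le> Re u" "Im l \<le> Im u"
    using le[of 1] le[of \<i>] by (auto simp: Basis_complex_def)
  have "emeasure (distr (lborel \<Otimes>\<^sub>M lborel) borel (\<lambda>(x, y). Complex x y)) (box l u)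
      = emeasure (lborel \<Otimes>\<^sub>M lborel) ({Re l<..<Re u} \<times> {Im l<..<Im u})"
    by (subst emeasure_distr)
       (auto simp: box_def Basis_complex_def space_pair_measure intro!: arg_cong2[where f=emeasure])
  also have "\<dots> = ennreal (Re u - Re l) * ennreal (Im u - Im l)"
    by (subst lborel.emeasure_pair_measure_Times) (auto simp: le')
  also have "\<dots> = (\<Prod>b\<in>Basis. (u - l) \<bullet> b)"
    using le' by (simp add: Basis_complex_def ennreal_mult)
  finally show "emeasure (distr (lborel \<Otimes>\<^sub>M lborel) borel (\<lambda>(x, y). Complex x y)) (box l u) = (\<Prod>b\<in>Basis. (u - l) \<bullet> b)" .
qed auto

text \<open>The imaginary part is the outer variable because \<open>rho\<close> does not depend on
  Re u_n: the inner integral over the real part then sees the factor \<open>rho\<close> to the power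
  b as a constant.\<close>

lemma nn_integral_lborel_complex:
  fixes f :: "complex \<Rightarrow> ennreal"
  assumes [measurable]: "f \<in> borel_measurable borel"
  shows "(\<integral>\<^sup>+z. f z \<partial>lborel) = (\<integral>\<^sup>+y. \<integral>\<^sup>+x. f (Complex x y) \<partial>lborel \<partial>lborel)"
proof -
  have [measurable]: "(\<lambda>(x, y). Complex x y) \<in> borel_measurable (borel \<Otimes>\<^sub>M borel)"
    by (simp add: borel_prod) (intro borel_measurable_continuous_onI, auto simp: case_prod_unfold Complex_eq intro!: continuous_intros)
  have "(\<integral>\<^sup>+z. f z \<partial>lborel) = (\<integral>\<^sup>+z. f (case z of (x, y) \<Rightarrow> Complex x y) \<partial>(lborel \<Otimes>\<^sub>M lborel))"
    by (subst lborel_complex_eq_distr, subst nn_integral_distr) auto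
  also have "\<dots> = (\<integral>\<^sup>+y. \<integral>\<^sup>+x. f (Complex x y) \<partial>lborel \<partial>lborel)"
    by (subst lborel_pair.nn_integral_snd[symmetric]) auto
  finally show ?thesis .
qed

text \<open>One complex variable is two real ones, and each real integration lowers the exponent s
  by 1/2; hence the arguments s, s - 1/2 and then s - 1. The factor \<open>(1/2) powr (-1/2)\<close>
  is the \<kappa> factor of \<open>nn_integral_shifted_quadratic_powr\<close> at \<kappa> =
  1/2.\<close>

primrec iter_quad_const :: "nat \<Rightarrow> real \<Rightarrow> ennreal" where
  "iter_quad_const 0 s = 1"
| "iter_quad_const (Suc m) s =
    (ennreal ((1/2) powr (-1/2)) * quad_const s) * (ennreal ((1/2) powr (-1/2)) * quad_const (s - 1/2))
      * iter_quad_const m (s - 1)"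

lemma iter_quad_const_pos: "iter_quad_const m s > 0"
  by (induction m arbitrary: s) (auto simp: ennreal_zero_less_mult_iff quad_const_pos)

text \<open>All factors are positive, so the product is finite exactly when each factor is. The
  exponent falls by 1 per complex variable, so the last one gives the strongest condition.\<close>

lemma iter_quad_const_finite: "iter_quad_const m s < \<infinity> \<longleftrightarrow> m = 0 \<or> s > real m"
proof (induction m arbitrary: s)
  case (Suc m)
  have "quad_const s \<noteq> 0" "quad_const (s - 1/2) \<noteq> 0" "iter_quad_const m (s - 1) \<noteq> 0"
    using quad_const_pos[of s] quad_const_pos[of "s - 1/2"] iter_quad_const_pos[of m "s - 1"] by auto
  then have "iter_quad_const (Suc m) s < \<infinity> \<longleftrightarrow> s > 1/2 \<and> s - 1/2 > 1/2 \<and> (m = 0 \<or> s - 1 > real m)"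
    using quad_const_finite[of s] quad_const_finite[of "s - 1/2"] Suc[of "s - 1"]
    by (auto simp: ennreal_mult_less_top ennreal_mult_eq_top_iff less_top)
  then show ?case by auto
qed simp

lemma nn_integral_complex_quadratic_powr:
  fixes \<Delta> s :: real and a :: complex
  assumes "\<Delta> > 0"
  shows "(\<integral>\<^sup>+y. ennreal ((\<Delta> + (cmod (a - y))\<^sup>2 / 2) powr (- s)) \<partial>lborel)
    = ennreal (\<Delta> powr (1 - s)) * ((ennreal ((1/2) powr (-1/2)) * quad_const s) * (ennreal ((1/2) powr (-1/2)) * quad_const (s - 1/2)))"
proof -
  let ?k = "ennreal ((1/2) powr (-1/2)) * quad_const s"
  have "(\<integral>\<^sup>+y. ennreal ((\<Delta> + (cmod (a - y))\<^sup>2 / 2) powr (- s)) \<partial>lborel)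
    = (\<integral>\<^sup>+y. \<integral>\<^sup>+x. ennreal (((\<Delta> + 1/2 * (y - Im a)\<^sup>2) + 1/2 * (x - Re a)\<^sup>2) powr (- s)) \<partial>lborel \<partial>lborel)"
    by (subst nn_integral_lborel_complex)
       (auto simp: cmod_power2 power2_commute[of "Re a"] power2_commute[of "Im a"] add_ac add_divide_distrib
         intro!: nn_integral_cong)
  also have "\<dots> = (\<integral>\<^sup>+y. ennreal ((\<Delta> + 1/2 * (y - Im a)\<^sup>2) powr (- (s - 1/2))) * ?k \<partial>lborel)"
    using assms
    by (intro nn_integral_cong, subst nn_integral_shifted_quadratic_powr) (auto intro!: add_pos_nonneg)
  also have "\<dots> = ennreal (\<Delta> powr (1/2 - (s - 1/2))) * (ennreal ((1/2) powr (-1/2)) * quad_const (s - 1/2)) * ?k"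
    using assms
    by (subst nn_integral_multc, simp, subst nn_integral_shifted_quadratic_powr) auto
  finally show ?thesis by (simp add: mult_ac)
qed

text \<open>Coordinate m is integrated first, with the remaining sum absorbed into the \<Delta> of
  \<open>nn_integral_complex_quadratic_powr\<close>. This replaces s by s - 1, which is why the
  induction keeps s arbitrary.\<close>

lemma nn_integral_PiM_quadratic_powr:
  fixes z :: "nat \<Rightarrow> complex"
  assumes "r > 0"
  shows "(\<integral>\<^sup>+x. ennreal ((r + (\<Sum>j<m. (cmod (z j - x j))\<^sup>2) / 2) powr (- s)) \<partial>PiM {..<m} (\<lambda>_. lborel))
    = ennreal (r powr (real m - s)) * iter_quad_const m s"
proof (induction m arbitrary: s)
  case 0
  interpret product_sigma_finite "\<lambda>_. lborel :: complex measure" by standard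
  show ?case by (simp add: PiM_empty)
next
  case (Suc m)
  interpret product_sigma_finite "\<lambda>_. lborel :: complex measure" by standard
  let ?k = "(ennreal ((1/2) powr (-1/2)) * quad_const s) * (ennreal ((1/2) powr (-1/2)) * quad_const (s - 1/2))"
  have "(\<integral>\<^sup>+x. ennreal ((r + (\<Sum>j<Suc m. (cmod (z j - x j))\<^sup>2) / 2) powr (- s)) \<partial>PiM {..<Suc m} (\<lambda>_. lborel))
    = (\<integral>\<^sup>+x. \<integral>\<^sup>+y. ennreal ((r + (\<Sum>j<Suc m. (cmod (z j - (x(m := y)) j))\<^sup>2) / 2) powr (- s)) \<partial>lborel \<partial>PiM {..<m} (\<lambda>_. lborel))"
    unfolding lessThan_Suc by (rule product_nn_integral_insert) auto
  also have "\<dots> = (\<integral>\<^sup>+x. \<integral>\<^sup>+y. ennreal ((r + (\<Sum>j<m. (cmod (z j - x j))\<^sup>2) / 2 + (cmod (z m - y))\<^sup>2 / 2) powr (- s)) \<partial>lborel \<partial>PiM {..<m} (\<lambda>_. lborel))"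
    by (intro nn_integral_cong arg_cong[where f=ennreal] arg_cong2[where f="(powr)"] refl)
       (simp add: add_divide_distrib add.assoc)
  also have "\<dots> = (\<integral>\<^sup>+x. ennreal ((r + (\<Sum>j<m. (cmod (z j - x j))\<^sup>2) / 2) powr (- (s - 1))) * ?k \<partial>PiM {..<m} (\<lambda>_. lborel))"
    using assms
    by (intro nn_integral_cong, subst nn_integral_complex_quadratic_powr)
       (auto intro!: add_pos_nonneg sum_nonneg)
  also have "\<dots> = ennreal (r powr (real m - (s - 1))) * iter_quad_const m (s - 1) * ?k"
    by (subst nn_integral_multc, simp) (simp only: Suc)
  finally show ?case by (simp add: mult_ac algebra_simps)
qed

section \<open>The Forelli-Rudin integral\<close>

text \<open>In each coordinate the parallelogram identity for the imaginary parts trades the square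
  of z_j - cnj u_j for |z_j - u_j|^2 minus 2 (Im z_j)^2 and 2 (Im u_j)^2. These subtracted squares
  combine with Im z_n and Im u_n to form \<open>rho n z\<close> and \<open>rho n u\<close>.\<close>

lemma Re_rho2:
  "Re (rho2 n z u) = ((\<Sum>j<n - 1. (cmod (z j - u j))\<^sup>2) / 2 + rho n z + rho n u) / 2"
proof -
  have "Re ((z j - cnj (u j))\<^sup>2) = (cmod (z j - u j))\<^sup>2 - 2 * (Im (z j))\<^sup>2 - 2 * (Im (u j))\<^sup>2" for j
    unfolding cmod_power2 by (simp add: power2_eq_square algebra_simps)
  then have "(\<Sum>j<n - 1. Re ((z j - cnj (u j))\<^sup>2)) = (\<Sum>j<n - 1. (cmod (z j - u j))\<^sup>2)
      - 2 * (\<Sum>j<n - 1. (Im (z j))\<^sup>2) - 2 * (\<Sum>j<n - 1. (Im (u j))\<^sup>2)"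
    by (simp only: sum_subtractf sum_distrib_left)
  then show ?thesis
    by (simp add: rho2_def rho_def field_simps)
qed

lemma Re_rho2_pos: "rho n z > 0 \<Longrightarrow> rho n u > 0 \<Longrightarrow> Re (rho2 n z u) > 0"
  unfolding Re_rho2 by (intro divide_pos_pos add_nonneg_pos add_nonneg_nonneg) (auto intro!: sum_nonneg)

lemma rho2_nonzero: "rho n z > 0 \<Longrightarrow> rho n u > 0 \<Longrightarrow> rho2 n z u \<noteq> 0"
  using Re_rho2_pos[of n z u] by auto

text \<open>The form shows Re u_n minus a quantity that does not involve u_n, so the integral over
  Re u_n is a translate of a fixed one.\<close>

lemma Im_rho2:
  "Im (rho2 n z u) = (Re (u (n - 1)) - (Re (z (n - 1)) - (\<Sum>j<n - 1. Re (z j - u j) * Im (z j + u j)))) / 2"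
proof -
  have "Im ((z j - cnj (u j))\<^sup>2) = 2 * (Re (z j - u j) * Im (z j + u j))" for j
    by (simp add: power2_eq_square algebra_simps)
  then have "(\<Sum>j<n - 1. Im ((z j - cnj (u j))\<^sup>2)) = 2 * (\<Sum>j<n - 1. Re (z j - u j) * Im (z j + u j))"
    by (simp only: sum_distrib_left)
  then show ?thesis
    by (simp add: rho2_def)
qed

definition forelli_rudin :: "nat \<Rightarrow> real \<Rightarrow> real \<Rightarrow> (nat \<Rightarrow> complex) \<Rightarrow> ennreal" where
  "forelli_rudin n b c z = (\<integral>\<^sup>+u. ennreal (rho n u powr b * cmod (rho2 n z u) powr (- c)) \<partial>dV n 0)"

text \<open>The factors come from integrating over \<open>Re u\<^sub>n\<close>, then \<open>Im u\<^sub>n\<close>, then \<open>u'\<close>.\<close>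

definition forelli_rudin_const :: "nat \<Rightarrow> real \<Rightarrow> real \<Rightarrow> ennreal" where
  "forelli_rudin_const n b c =
    ennreal (2 powr (c - 1)) * (ennreal ((1/4) powr (-1/2)) * quad_const (c / 2)) * beta_const b (c - 1)
      * iter_quad_const (n - 1) (c - 2 - b)"

lemma forelli_rudin_const_pos: "forelli_rudin_const n b c > 0"
  unfolding forelli_rudin_const_def
  using quad_const_pos beta_const_pos iter_quad_const_pos by (simp add: ennreal_zero_less_mult_iff)

text \<open>Finiteness of the positive factors gives c > 1, b > -1, c > b + 2 and, for n > 1, c > n
  + 1 + b. Given b > -1, the last condition implies the other two on c; for n = 1 the condition c >
  b + 2 is already the stated one.\<close>

lemma forelli_rudin_const_finite:
  assumes "n \<ge> 1"
  shows "forelli_rudin_const n b c < \<infinity> \<longleftrightarrow> b > -1 \<and> c > real n + 1 + b"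
proof -
  have "quad_const (c/2) \<noteq> 0" "beta_const b (c - 1) \<noteq> 0" "iter_quad_const (n - 1) (c - 2 - b) \<noteq> 0"
    using quad_const_pos[of "c/2"] beta_const_pos[of b "c - 1"] iter_quad_const_pos[of "n - 1" "c - 2 - b"] by auto
  then have "forelli_rudin_const n b c < \<infinity> \<longleftrightarrow> c / 2 > 1/2 \<and> (b > -1 \<and> c - 1 > b + 1) \<and> (n - 1 = 0 \<or> c - 2 - b > real (n - 1))"
    unfolding quad_const_finite[symmetric] beta_const_finite[symmetric] iter_quad_const_finite[symmetric]
    by (auto simp: forelli_rudin_const_def ennreal_mult_less_top ennreal_mult_eq_top_iff less_top)
  then show ?thesis using assms by (auto simp: of_nat_diff)
qed

section \<open>Measurability on the tube domain and the exact scaling identity\<close>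

locale tube =
  fixes n :: nat
  assumes n: "n \<ge> 1"
begin

lemma coord_measurable:
  assumes "f \<in> M \<rightarrow>\<^sub>M Cn n" "j < n"
  shows "(\<lambda>x. f x j) \<in> borel_measurable M"
  using measurable_compose[OF assms(1)[unfolded Cn_def] measurable_component_singleton[of j]] assms(2)
  by simp

lemma rho_measurable [measurable (raw)]:
  assumes "f \<in> M \<rightarrow>\<^sub>M Cn n"
  shows "(\<lambda>x. rho n (f x)) \<in> borel_measurable M"
proof -
  have [measurable]: "(\<lambda>x. f x j) \<in> borel_measurable M" if "j < n" for j
    using coord_measurable[OF assms that] .
  have [measurable]: "(\<lambda>x. \<Sum>j<n - 1. (Im (f x j))\<^sup>2) \<in> borel_measurable M"
    by (intro borel_measurable_sum borel_measurable_power) auto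
  have [measurable]: "(\<lambda>x. f x (n - 1)) \<in> borel_measurable M" using n by simp
  show ?thesis unfolding rho_def by measurable
qed

lemma rho2_measurable [measurable (raw)]:
  assumes "f \<in> M \<rightarrow>\<^sub>M Cn n" "g \<in> M \<rightarrow>\<^sub>M Cn n"
  shows "(\<lambda>x. rho2 n (f x) (g x)) \<in> borel_measurable M"
proof -
  have cnj: "cnj \<in> borel_measurable borel"
    by (intro borel_measurable_continuous_onI continuous_intros)
  have [measurable]: "(\<lambda>x. f x j) \<in> borel_measurable M" "(\<lambda>x. g x j) \<in> borel_measurable M"
      "(\<lambda>x. cnj (g x j)) \<in> borel_measurable M" if "j < n" for j
    using coord_measurable[OF assms(1) that] coord_measurable[OF assms(2) that]
    by (auto intro: measurable_compose[OF _ cnj])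
  have [measurable]: "(\<lambda>x. \<Sum>j<n - 1. (f x j - cnj (g x j))\<^sup>2) \<in> borel_measurable M"
    by (intro borel_measurable_sum borel_measurable_power borel_measurable_diff) auto
  have [measurable]: "(\<lambda>x. f x (n - 1)) \<in> borel_measurable M" "(\<lambda>x. cnj (g x (n - 1))) \<in> borel_measurable M"
    using n by simp_all
  show ?thesis unfolding rho2_def by measurable
qed

lemma TB_sets [measurable]: "TB n \<in> sets (Cn n)"
  unfolding TB_def by measurable

lemma sets_dV [measurable_cong, simp]: "sets (dV n \<alpha>) = sets (Cn n)"
  by (simp add: dV_def)

lemma space_dV [simp]: "space (dV n \<alpha>) = space (Cn n)"
  by (simp add: dV_def)

lemma nn_integral_dV:
  assumes [measurable]: "f \<in> borel_measurable (Cn n)"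
  shows "(\<integral>\<^sup>+u. f u \<partial>dV n \<alpha>) = (\<integral>\<^sup>+u. ennreal (rho n u powr \<alpha>) * f u \<partial>dV n 0)"
  unfolding dV_def
  by (subst (1 2) nn_integral_density) (auto intro!: nn_integral_cong simp: indicator_def TB_def)

text \<open>Every step is a Tonelli or substitution identity in \<open>ennreal\<close>, so the
  formula also covers the divergent case, where the constant is infinite. Necessity of the parameter
  conditions relies on this.\<close>

lemma forelli_rudin_eq:
  assumes "rho n z > 0"
  shows "forelli_rudin n b c z = ennreal (rho n z powr (real n + 1 + b - c)) * forelli_rudin_const n b c"
proof -
  obtain m where m: "n = Suc m" using n by (cases n) auto
  interpret product_sigma_finite "\<lambda>_. lborel :: complex measure" by standard
  define k where "k = ennreal (2 powr (c - 1)) * (ennreal ((1/4) powr (-1/2)) * quad_const (c / 2))"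
  \<comment> \<open>By \<open>Re_rho2\<close> this is 2 Re \<rho>(z,u) with the summand \<rho>(u)
    removed; it depends on u' only.\<close>
  define \<Delta> where "\<Delta> x = rho n z + (\<Sum>j<m. (cmod (z j - x j))\<^sup>2) / 2" for x
  have \<Delta>: "\<Delta> x > 0" for x
    unfolding \<Delta>_def using assms by (intro add_pos_nonneg) (auto intro!: sum_nonneg)
  define h where "h u = indicator (TB n) u * ennreal (rho n u powr b * cmod (rho2 n z u) powr (- c))" for u
  \<comment> \<open>Here z is an arbitrary function, while measurability is available for points of
    \<open>Cn n\<close>. Since \<open>rho2\<close> reads only coordinates below n, z may be
    restricted to them.\<close>
  have z: "(\<lambda>u. rho2 n z u) \<in> borel_measurable (Cn n)"
  proof -
    have "restrict z {..<n} \<in> space (Cn n)" by (simp add: Cn_def space_PiM)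
    then have "(\<lambda>u. rho2 n (restrict z {..<n}) u) \<in> borel_measurable (Cn n)" by measurable
    also have "(\<lambda>u. rho2 n (restrict z {..<n}) u) = (\<lambda>u. rho2 n z u)"
      using n by (auto simp: rho2_def fun_eq_iff intro!: sum.cong)
    finally show ?thesis .
  qed
  then have h_meas: "h \<in> borel_measurable (Cn n)"
    unfolding h_def by measurable
  have inner: "(\<integral>\<^sup>+y. h (x(m := y)) \<partial>lborel) = ennreal (\<Delta> x powr (- (c - 2 - b))) * (k * beta_const b (c - 1))"
    if x: "x \<in> space (PiM {..<m} (\<lambda>_. lborel))" for x
  proof -
    define \<beta> where "\<beta> = (\<Sum>j<m. (Im (x j))\<^sup>2)"
    define a where "a = Re (z m) - (\<Sum>j<m. Re (z j - x j) * Im (z j + x j))"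
    have xm: "x(m := y) \<in> space (Cn n)" for y
      using x by (auto simp: Cn_def space_PiM m PiE_def extensional_def)
    have rho_x: "rho n (x(m := y)) = Im y - \<beta>" for y
      by (simp add: rho_def m \<beta>_def)
    have TB_x: "x(m := y) \<in> TB n \<longleftrightarrow> Im y > \<beta>" for y
      using xm by (simp add: TB_def rho_x)
    have Re_x: "Re (rho2 n z (x(m := y))) = (\<Delta> x + (Im y - \<beta>)) / 2" for y
      by (simp add: Re_rho2 rho_x) (simp add: m \<Delta>_def)
    have Im_x: "Im (rho2 n z (x(m := y))) = (Re y - a) / 2" for y
      by (simp add: Im_rho2 m a_def)
    \<comment> \<open>The squared modulus has the shape \<Delta> + \<kappa> (s - a)^2 in s = Re u_n
      with \<kappa> = 1/4, and the power -c of the modulus becomes the power -c/2 of its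
      square.\<close>
    have norm_x: "cmod (rho2 n z (x(m := y))) powr (- c)
        = (((\<Delta> x + (Im y - \<beta>)) / 2)\<^sup>2 + 1/4 * (Re y - a)\<^sup>2) powr (- (c/2))" if "Im y > \<beta>" for y
    proof -
      have "(cmod (rho2 n z (x(m := y))))\<^sup>2 = ((\<Delta> x + (Im y - \<beta>)) / 2)\<^sup>2 + 1/4 * (Re y - a)\<^sup>2"
        by (simp add: cmod_power2 Re_x Im_x power_divide)
      moreover have "cmod (rho2 n z (x(m := y))) > 0"
        using rho2_nonzero[of n z "x(m := y)"] assms that by (simp add: rho_x)
      then have "cmod (rho2 n z (x(m := y))) powr (- c) = ((cmod (rho2 n z (x(m := y))))\<^sup>2) powr (- (c/2))"
        by (simp add: powr_powr flip: powr_numeral)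
      ultimately show ?thesis by simp
    qed
    have upd: "(\<lambda>y. x(m := y)) \<in> borel \<rightarrow>\<^sub>M Cn n"
      using measurable_component_update[of x "{..<m}" "\<lambda>_. lborel" m] x by (simp add: Cn_def m lessThan_Suc)
    have meas: "(\<lambda>y. h (x(m := y))) \<in> borel_measurable borel"
      by (rule measurable_compose[OF upd h_meas])
    have "(\<integral>\<^sup>+y. h (x(m := y)) \<partial>lborel) = (\<integral>\<^sup>+t. \<integral>\<^sup>+s. h (x(m := Complex s t)) \<partial>lborel \<partial>lborel)"
      by (rule nn_integral_lborel_complex[OF meas])
    also have "\<dots> = (\<integral>\<^sup>+t. k * (indicator {\<beta><..} t * ennreal ((t - \<beta>) powr b * (\<Delta> x + (t - \<beta>)) powr (- (c - 1)))) \<partial>lborel)"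
    proof (intro nn_integral_cong)
      fix t :: real
      show "(\<integral>\<^sup>+s. h (x(m := Complex s t)) \<partial>lborel)
        = k * (indicator {\<beta><..} t * ennreal ((t - \<beta>) powr b * (\<Delta> x + (t - \<beta>)) powr (- (c - 1))))"
      proof (cases "t > \<beta>")
        case True
        define R where "R = (\<Delta> x + (t - \<beta>)) / 2"
        have R: "R > 0" using True \<Delta>[of x] by (simp add: R_def)
        have "(\<integral>\<^sup>+s. h (x(m := Complex s t)) \<partial>lborel)
          = (\<integral>\<^sup>+s. ennreal ((t - \<beta>) powr b) * ennreal ((R\<^sup>2 + 1/4 * (s - a)\<^sup>2) powr (- (c/2))) \<partial>lborel)"
          unfolding h_def using True
          by (intro nn_integral_cong) (simp add: TB_x rho_x norm_x R_def[symmetric] ennreal_mult)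
        also have "\<dots> = ennreal ((t - \<beta>) powr b) * (ennreal ((R\<^sup>2) powr (1/2 - c/2)) * (ennreal ((1/4) powr (-1/2)) * quad_const (c/2)))"
          using R by (subst nn_integral_cmult, simp, subst nn_integral_shifted_quadratic_powr) auto
        \<comment> \<open>Integrating over Re u_n costs one power: c becomes c - 1. The factor
          \<open>2 powr (c - 1)\<close> comes from the halving in \<open>R\<close>.\<close>
        also have "(R\<^sup>2) powr (1/2 - c/2) = R powr (1 - c)"
          using R by (simp add: powr_powr algebra_simps flip: powr_numeral)
        also have "\<dots> = 2 powr (c - 1) * (\<Delta> x + (t - \<beta>)) powr (- (c - 1))"
          using True \<Delta>[of x] by (simp add: R_def powr_divide powr_diff)
        finally show ?thesis using True
          by (simp add: k_def ennreal_mult mult_ac del: fun_upd_apply)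
      next
        case False
        then show ?thesis by (simp add: h_def TB_x)
      qed
    qed
    also have "\<dots> = k * (ennreal (\<Delta> x powr (1 + b - (c - 1))) * beta_const b (c - 1))"
      using \<Delta>[of x] by (subst nn_integral_cmult, simp, subst nn_integral_shifted_beta) auto
    finally show ?thesis by (simp add: mult_ac algebra_simps)
  qed
  have "forelli_rudin n b c z = (\<integral>\<^sup>+u. h u \<partial>Cn n)"
    unfolding forelli_rudin_def dV_def h_def using z
    by (subst nn_integral_density) (auto intro!: nn_integral_cong simp: indicator_def TB_def)
  also have "\<dots> = (\<integral>\<^sup>+x. \<integral>\<^sup>+y. h (x(m := y)) \<partial>lborel \<partial>PiM {..<m} (\<lambda>_. lborel))"
    using h_meas unfolding Cn_def m lessThan_Suc by (intro product_nn_integral_insert) auto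
  also have "\<dots> = (\<integral>\<^sup>+x. ennreal (\<Delta> x powr (- (c - 2 - b))) * (k * beta_const b (c - 1)) \<partial>PiM {..<m} (\<lambda>_. lborel))"
    by (intro nn_integral_cong inner)
  also have "\<dots> = ennreal (rho n z powr (real m - (c - 2 - b))) * iter_quad_const m (c - 2 - b) * (k * beta_const b (c - 1))"
    unfolding \<Delta>_def using assms by (subst nn_integral_multc, simp, subst nn_integral_PiM_quadratic_powr) auto
  finally show ?thesis
    by (simp add: forelli_rudin_const_def k_def m mult_ac algebra_simps)
qed

end

section \<open>Essential suprema and null sets\<close>

text \<open>The essential supremum exceeds y exactly when the section where f exceeds y has positive
  measure, and the measure of a section depends measurably on the parameter.\<close>

lemma borel_measurable_esssup:
  fixes f :: "'a \<times> 'b \<Rightarrow> ennreal"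
  assumes "sigma_finite_measure M" and [measurable]: "f \<in> borel_measurable (M \<Otimes>\<^sub>M N)"
  shows "(\<lambda>w. esssup M (\<lambda>z. f (z, w))) \<in> borel_measurable N"
proof (rule borel_measurableI_greater)
  fix y :: ennreal
  interpret sigma_finite_measure M by fact
  have "y < esssup M (\<lambda>z. f (z, w)) \<longleftrightarrow> (\<integral>\<^sup>+z. indicator {y<..} (f (z, w)) \<partial>M) > 0" if w: "w \<in> space N" for w
  proof -
    have [measurable]: "(\<lambda>z. f (z, w)) \<in> borel_measurable M"
      using w by measurable
    have "(\<integral>\<^sup>+z. indicator {y<..} (f (z, w)) \<partial>M) = (\<integral>\<^sup>+z. indicator {z\<in>space M. y < f (z, w)} z \<partial>M)"
      by (intro nn_integral_cong) (auto simp: indicator_def)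
    also have "\<dots> = emeasure M {z\<in>space M. y < f (z, w)}"
      by (rule nn_integral_indicator) measurable
    finally have eq: "(\<integral>\<^sup>+z. indicator {y<..} (f (z, w)) \<partial>M) = emeasure M {z\<in>space M. y < f (z, w)}" .
    have "emeasure M {z\<in>space M. y < f (z, w)} = 0" if "esssup M (\<lambda>z. f (z, w)) \<le> y"
    proof -
      have "emeasure M {z\<in>space M. y < f (z, w)} \<le> emeasure M {z\<in>space M. esssup M (\<lambda>z. f (z, w)) < f (z, w)}"
        using that by (intro emeasure_mono) auto
      then show ?thesis using esssup_zero_measure[of M "\<lambda>z. f (z, w)"] by simp
    qed
    moreover have "emeasure M {z\<in>space M. y < f (z, w)} > 0" if "y < esssup M (\<lambda>z. f (z, w))"
      using that by (intro esssup_pos_measure) measurable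
    ultimately show ?thesis unfolding eq
      by (cases "y < esssup M (\<lambda>z. f (z, w))") (simp_all add: not_less)
  qed
  then have "{w \<in> space N. y < esssup M (\<lambda>z. f (z, w))} = {w \<in> space N. (\<integral>\<^sup>+z. indicator {y<..} (f (z, w)) \<partial>M) > 0}"
    by auto
  also have "\<dots> \<in> sets N" by measurable
  finally show "{w \<in> space N. y < esssup M (\<lambda>z. f (z, w))} \<in> sets N" .
qed

lemma enn_powr_ennreal: "0 \<le> x \<Longrightarrow> enn_powr (ennreal x) r = ennreal (x powr r)"
  by (simp add: enn_powr_def)

lemma enn_powr_mono:
  assumes "x \<le> y" "r \<ge> 0" shows "enn_powr x r \<le> enn_powr y r"
proof (cases y)
  case (real y')
  then obtain x' where "x = ennreal x'" "x' \<ge> 0"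
    using assms(1) by (cases x) (auto simp: top_unique)
  with real assms show ?thesis
    by (auto simp: enn_powr_ennreal intro!: ennreal_leI powr_mono2)
qed (simp add: enn_powr_def)

lemma borel_measurable_enn_powr [measurable (raw)]:
  assumes [measurable]: "f \<in> borel_measurable M"
  shows "(\<lambda>x. enn_powr (f x) r) \<in> borel_measurable M"
  unfolding enn_powr_def by measurable

context tube begin

lemma sigma_finite_Cn: "sigma_finite_measure (Cn n)"
proof -
  interpret finite_product_sigma_finite "\<lambda>_. lborel :: complex measure" "{..<n}" by standard auto
  show ?thesis unfolding Cn_def by unfold_locales
qed

lemma sigma_finite_dV: "sigma_finite_measure (dV n \<alpha>)"
proof -
  interpret sigma_finite_measure "Cn n" by (rule sigma_finite_Cn)
  show ?thesis unfolding dV_def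
    by (subst sigma_finite_iff_density_finite) (auto simp: ennreal_mult_eq_top_iff indicator_def)
qed

sublocale dV0: pair_sigma_finite "dV n 0" "dV n 0"
  using sigma_finite_dV by (intro pair_sigma_finite.intro)

text \<open>The density is strictly positive on \<open>TB n\<close>, so the null sets are the same
  for every \<alpha>. This moves essential suprema from \<open>dV n \<alpha>1\<close> to
  \<open>dV n 0\<close>.\<close>

lemma AE_dV_iff: "(AE z in dV n \<alpha>. P z) \<longleftrightarrow> (AE z in Cn n. z \<in> TB n \<longrightarrow> P z)"
proof -
  have "(AE z in dV n \<alpha>. P z) \<longleftrightarrow> (AE z in Cn n. 0 < indicator (TB n) z * ennreal (rho n z powr \<alpha>) \<longrightarrow> P z)"
    unfolding dV_def by (rule AE_density) measurable
  also have "\<dots> \<longleftrightarrow> (AE z in Cn n. z \<in> TB n \<longrightarrow> P z)"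
    by (rule AE_cong) (auto simp: indicator_def TB_def)
  finally show ?thesis .
qed

lemma AE_dV0_pair: "AE x in dV n 0 \<Otimes>\<^sub>M dV n 0. fst x \<in> TB n \<and> snd x \<in> TB n"
proof (rule dV0.AE_pair_measure)
  show "{x \<in> space (dV n 0 \<Otimes>\<^sub>M dV n 0). fst x \<in> TB n \<and> snd x \<in> TB n} \<in> sets (dV n 0 \<Otimes>\<^sub>M dV n 0)"
    by measurable
  show "AE z in dV n 0. AE w in dV n 0. fst (z, w) \<in> TB n \<and> snd (z, w) \<in> TB n"
    unfolding AE_dV_iff by simp
qed

text \<open>The mixed norm takes the supremum in w outermost, so the quantifiers are wanted in this
  order. As P may be non-measurable, the exchange is made for a measurable null set that contains
  the exceptional set.\<close>

lemma AE_pair_swap: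
  assumes "AE x in dV n 0 \<Otimes>\<^sub>M dV n 0. P x"
  shows "AE w in dV n 0. AE z in dV n 0. P (z, w)"
proof -
  obtain N where N: "{x \<in> space (dV n 0 \<Otimes>\<^sub>M dV n 0). \<not> P x} \<subseteq> N"
      "emeasure (dV n 0 \<Otimes>\<^sub>M dV n 0) N = 0" "N \<in> sets (dV n 0 \<Otimes>\<^sub>M dV n 0)"
    using assms by (rule AE_E)
  have "AE x in dV n 0 \<Otimes>\<^sub>M dV n 0. x \<notin> N"
    using N by (intro AE_not_in) (auto simp: null_sets_def)
  then have "AE z in dV n 0. AE w in dV n 0. (z, w) \<notin> N"
    by (rule dV0.AE_pair)
  then have "AE w in dV n 0. AE z in dV n 0. (z, w) \<notin> N"
  proof (subst dV0.AE_commute[of "\<lambda>z w. (z, w) \<notin> N", symmetric])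
    have "{x \<in> space (dV n 0 \<Otimes>\<^sub>M dV n 0). (fst x, snd x) \<notin> N} = space (dV n 0 \<Otimes>\<^sub>M dV n 0) - N"
      by auto
    then show "{x \<in> space (dV n 0 \<Otimes>\<^sub>M dV n 0). (fst x, snd x) \<notin> N} \<in> sets (dV n 0 \<Otimes>\<^sub>M dV n 0)"
      using N(3) by (metis sets.compl_sets)
  qed
  with AE_space show ?thesis
  proof eventually_elim
    case (elim w)
    from AE_space elim(2) show ?case
      by eventually_elim (use N(1) elim(1) in \<open>auto simp: space_pair_measure\<close>)
  qed
qed

end

section \<open>Local uniform control of the kernels\<close>

context tube begin

text \<open>Points are functions on all of \<open>nat\<close>, so closeness is measured by polydiscs
  in the coordinates below n.\<close>

definition near :: "real \<Rightarrow> (nat \<Rightarrow> complex) \<Rightarrow> (nat \<Rightarrow> complex) \<Rightarrow> bool" where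
  "near \<delta> z0 z \<longleftrightarrow> (\<forall>j<n. cmod (z j - z0 j) < \<delta>)"

lemma near_mono: "near \<delta> z0 z \<Longrightarrow> \<delta> \<le> \<epsilon> \<Longrightarrow> near \<epsilon> z0 z"
  by (force simp: near_def)

lemma rho_close:
  assumes "e > 0"
  obtains \<delta> where "\<delta> > 0" "\<And>z. near \<delta> z0 z \<Longrightarrow> \<bar>rho n z - rho n z0\<bar> < e"
proof -
  \<comment> \<open>For \<delta> \<le> 1 the factor 1 + 2 |z0_j| bounds |Im z_j + Im z0_j|. Of the
    leading 2, one unit accounts for the last coordinate and the other makes the final inequality
    strict.\<close>
  define M where "M = 2 + (\<Sum>j<n - 1. 1 + 2 * cmod (z0 j))"
  have M: "M > 0" unfolding M_def by (intro add_pos_nonneg sum_nonneg) auto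
  define \<delta> where "\<delta> = min 1 (e / M)"
  have \<delta>: "\<delta> > 0" "\<delta> \<le> 1" "\<delta> * M \<le> e"
    using M assms by (auto simp: \<delta>_def min_def field_simps)
  have "\<bar>rho n z - rho n z0\<bar> < e" if z: "near \<delta> z0 z" for z
  proof -
    have Im: "\<bar>Im (z j) - Im (z0 j)\<bar> < \<delta>" if "j < n" for j
      using z that abs_Im_le_cmod[of "z j - z0 j"] unfolding near_def
      by (metis minus_complex.sel(2) order.strict_trans1)
    have sq: "\<bar>(Im (z j))\<^sup>2 - (Im (z0 j))\<^sup>2\<bar> \<le> \<delta> * (1 + 2 * cmod (z0 j))" if "j < n" for j
    proof -
      have "(Im (z j))\<^sup>2 - (Im (z0 j))\<^sup>2 = (Im (z j) - Im (z0 j)) * ((Im (z j) - Im (z0 j)) + 2 * Im (z0 j))"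
        by (simp add: power2_eq_square algebra_simps)
      then have "\<bar>(Im (z j))\<^sup>2 - (Im (z0 j))\<^sup>2\<bar> = \<bar>Im (z j) - Im (z0 j)\<bar> * \<bar>(Im (z j) - Im (z0 j)) + 2 * Im (z0 j)\<bar>"
        by (simp add: abs_mult)
      also have "\<dots> \<le> \<delta> * (1 + 2 * cmod (z0 j))"
        using Im[OF that] abs_Im_le_cmod[of "z0 j"] \<delta> by (intro mult_mono) linarith+
      finally show ?thesis .
    qed
    have "rho n z - rho n z0 = (Im (z (n - 1)) - Im (z0 (n - 1))) - (\<Sum>j<n - 1. (Im (z j))\<^sup>2 - (Im (z0 j))\<^sup>2)"
      by (simp add: rho_def sum_subtractf)
    also have "\<bar>\<dots>\<bar> \<le> \<bar>Im (z (n - 1)) - Im (z0 (n - 1))\<bar> + (\<Sum>j<n - 1. \<bar>(Im (z j))\<^sup>2 - (Im (z0 j))\<^sup>2\<bar>)"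
      using sum_abs[of "\<lambda>j. (Im (z j))\<^sup>2 - (Im (z0 j))\<^sup>2" "{..<n - 1}"] by linarith
    also have "\<dots> \<le> \<delta> + (\<Sum>j<n - 1. \<delta> * (1 + 2 * cmod (z0 j)))"
      using Im[of "n - 1"] n sq by (intro add_mono sum_mono) auto
    also have "\<dots> < \<delta> * M"
      using \<delta> unfolding M_def sum_distrib_left[symmetric] by (simp add: algebra_simps)
    finally show ?thesis using \<delta> by linarith
  qed
  with \<delta> that show ?thesis by blast
qed

lemma rho_powr_close:
  assumes "rho n z0 > 0"
  obtains \<delta> where "\<delta> > 0" "\<And>z. near \<delta> z0 z \<Longrightarrow> rho n z > 0 \<and> rho n z0 powr a \<le> 2 * rho n z powr a"
proof -
  have "\<forall>\<^sub>F r in nhds (rho n z0). r > 0"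
    using assms by (intro eventually_nhds_in_open[of "{0<..}", simplified]) auto
  moreover have "((\<lambda>r. r powr a) \<longlongrightarrow> rho n z0 powr a) (nhds (rho n z0))"
    using assms by (intro tendsto_intros filterlim_ident) auto
  then have "\<forall>\<^sub>F r in nhds (rho n z0). r powr a > rho n z0 powr a / 2"
    using assms by (intro order_tendstoD) auto
  ultimately have "\<forall>\<^sub>F r in nhds (rho n z0). r > 0 \<and> rho n z0 powr a \<le> 2 * r powr a"
    by eventually_elim auto
  then obtain e where e: "e > 0" "\<And>r. dist r (rho n z0) < e \<Longrightarrow> r > 0 \<and> rho n z0 powr a \<le> 2 * r powr a"
    unfolding eventually_nhds_metric by blast
  obtain \<delta> where "\<delta> > 0" "\<And>z. near \<delta> z0 z \<Longrightarrow> \<bar>rho n z - rho n z0\<bar> < e"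
    using rho_close[OF e(1), of z0] by blast
  with e that show ?thesis by (auto simp: dist_real_def)
qed

text \<open>A small polydisc around z0 lies in the tube and has positive measure, so it is not
  contained in the exceptional null set. This replaces an almost everywhere bound by a bound at one
  point as close to z0 as desired.\<close>

lemma AE_dV_imp_near:
  assumes "\<delta> > 0" "z0 \<in> TB n" "AE z in dV n \<alpha>. P z"
  obtains z where "z \<in> TB n" "near \<delta> z0 z" "P z"
proof -
  have "rho n z0 > 0" using assms(2) by (simp add: TB_def)
  \<comment> \<open>The exponent 0 makes the second conjunct harmless; only the positivity of
    \<open>rho\<close> near z0 is wanted.\<close>
  then obtain \<epsilon> where \<epsilon>: "\<epsilon> > 0" "\<And>z. near \<epsilon> z0 z \<Longrightarrow> rho n z > 0 \<and> rho n z0 powr 0 \<le> 2 * rho n z powr 0"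
    using rho_powr_close[of z0 0] by blast
  define r where "r = min \<delta> \<epsilon>"
  have r: "r > 0" "r \<le> \<delta>" "r \<le> \<epsilon>" using assms \<epsilon> by (auto simp: r_def)
  define N where "N = PiE {..<n} (\<lambda>j. ball (z0 j) r)"
  have N: "N \<in> sets (Cn n)" unfolding N_def Cn_def by (intro sets_PiM_I_finite) auto
  interpret product_sigma_finite "\<lambda>_. lborel :: complex measure" by standard
  have "emeasure (Cn n) N = (\<Prod>j<n. emeasure lborel (ball (z0 j) r))"
    unfolding N_def Cn_def by (intro emeasure_PiM) auto
  also have "\<dots> \<noteq> 0"
  proof -
    have "emeasure lborel (ball (z0 j) r) \<noteq> 0" for j
      using r(1) less_imp_neq[OF unit_ball_vol_pos[of 2]] by (simp add: emeasure_ball)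
    then show ?thesis by simp
  qed
  finally have pos: "emeasure (Cn n) N \<noteq> 0" .
  have nr: "near r z0 z \<and> z \<in> space (Cn n)" if "z \<in> N" for z
    using that by (auto simp: N_def near_def Cn_def space_PiM PiE_def Pi_def dist_norm norm_minus_commute)
  have "\<exists>z. z \<in> TB n \<and> near \<delta> z0 z \<and> P z"
  proof (rule ccontr)
    assume no: "\<not> ?thesis"
    have "AE z in Cn n. z \<in> TB n \<longrightarrow> P z" using assms(3) by (simp add: AE_dV_iff)
    then have "AE z in Cn n. z \<notin> N"
    proof (rule AE_mp, intro AE_I2 impI notI)
      fix z assume "z \<in> TB n \<longrightarrow> P z" "z \<in> N"
      then show False using no nr[of z] r \<epsilon>(2)[of z] near_mono[of r z0 z] by (auto simp: TB_def)
    qed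
    then have "N \<in> null_sets (Cn n)" using N by (simp add: AE_iff_null_sets)
    with pos show False by auto
  qed
  with that show ?thesis by blast
qed

text \<open>The radius has to be uniform in the unbounded variable u, so the error is measured
  relative to \<rho>(z0,u). The difference grows at most linearly in d_j = |z0_j - u_j|, while the
  real part of \<rho>(z0,u) controls the sum of the d_j^2 and is at least \<rho>(z0)/2. The bound 2
  d_j \<le> 1 + d_j^2 connects the two.\<close>

lemma rho2_close:
  assumes z0: "rho n z0 > 0" and \<epsilon>: "\<epsilon> > 0"
  obtains \<delta> where "\<delta> > 0"
    "\<And>z u. near \<delta> z0 z \<Longrightarrow> rho n u > 0 \<Longrightarrow> cmod (rho2 n z u - rho2 n z0 u) \<le> \<epsilon> * cmod (rho2 n z0 u)"
proof -
  \<comment> \<open>\<open>A\<close> collects the part of the error that is free of u, with 2 for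
    the last coordinate. With R = Re \<rho>(z0,u) one has \<rho>(z0) \<le> 2 R and a sum of d_j^2 of
    at most 4 R, which gives the two summands of \<open>M\<close>; the division by 4 is the
    prefactor of \<open>rho2\<close>.\<close>
  define A where "A = (\<Sum>j<n - 1. 7 + 4 * cmod (z0 j)) + 2"
  have A: "A > 0" unfolding A_def by (intro add_nonneg_pos sum_nonneg) auto
  define M where "M = (2 * A / rho n z0 + 24) / 4"
  have M: "M > 0" unfolding M_def using A z0 by (auto intro!: add_pos_pos)
  define \<delta> where "\<delta> = min 1 (\<epsilon> / M)"
  have \<delta>: "\<delta> > 0" "\<delta> \<le> 1" "\<delta> * M \<le> \<epsilon>"
    using M \<epsilon> by (auto simp: \<delta>_def min_def field_simps)
  have "cmod (rho2 n z u - rho2 n z0 u) \<le> \<epsilon> * cmod (rho2 n z0 u)" if z: "near \<delta> z0 z" and u: "rho n u > 0" for z u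
  proof -
    define d where "d j = cmod (z0 j - u j)" for j
    define R where "R = Re (rho2 n z0 u)"
    have R: "R = ((\<Sum>j<n - 1. (d j)\<^sup>2) / 2 + rho n z0 + rho n u) / 2"
      unfolding R_def Re_rho2 d_def ..
    have dsum: "(\<Sum>j<n - 1. (d j)\<^sup>2) \<ge> 0" by (intro sum_nonneg) auto
    have step: "cmod ((z j - cnj (u j))\<^sup>2 - (z0 j - cnj (u j))\<^sup>2) \<le> \<delta> * (7 + 4 * cmod (z0 j) + 6 * (d j)\<^sup>2)" if "j < n" for j
    proof -
      have zj: "cmod (z j - z0 j) \<le> \<delta>" using z that by (simp add: near_def less_imp_le)
      have "u j - cnj (u j) = 2 * \<i> * Im (u j)" by (simp add: complex_eq_iff)
      have "\<bar>Im (u j)\<bar> \<le> d j + cmod (z0 j)"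
        using abs_Im_le_cmod[of "z0 j - u j"] abs_Im_le_cmod[of "z0 j"] unfolding d_def by simp
      moreover have "cmod (u j - cnj (u j)) = 2 * \<bar>Im (u j)\<bar>"
        unfolding \<open>u j - cnj (u j) = 2 * \<i> * Im (u j)\<close> by (simp add: norm_mult)
      moreover have "cmod (z0 j - cnj (u j)) \<le> d j + cmod (u j - cnj (u j))"
        using norm_triangle_ineq[of "z0 j - u j" "u j - cnj (u j)"] by (simp add: d_def)
      ultimately have "cmod (z0 j - cnj (u j)) \<le> 3 * d j + 2 * cmod (z0 j)" by linarith
      moreover have "2 * d j \<le> 1 + (d j)\<^sup>2" using sum_squares_bound[of 1 "d j"] by simp
      moreover have "cmod ((z j - z0 j) + 2 * (z0 j - cnj (u j))) \<le> cmod (z j - z0 j) + 2 * cmod (z0 j - cnj (u j))"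
        using norm_triangle_ineq[of "z j - z0 j" "2 * (z0 j - cnj (u j))"] unfolding norm_mult by simp
      moreover have "d j \<ge> 0" by (simp add: d_def)
      ultimately have *: "cmod ((z j - z0 j) + 2 * (z0 j - cnj (u j))) \<le> 7 + 4 * cmod (z0 j) + 6 * (d j)\<^sup>2"
        using zj \<delta> zero_le_power2[of "d j"] by linarith
      have "(z j - cnj (u j))\<^sup>2 - (z0 j - cnj (u j))\<^sup>2 = (z j - z0 j) * ((z j - z0 j) + 2 * (z0 j - cnj (u j)))"
        by (simp add: power2_eq_square algebra_simps)
      then have "cmod ((z j - cnj (u j))\<^sup>2 - (z0 j - cnj (u j))\<^sup>2) = cmod (z j - z0 j) * cmod ((z j - z0 j) + 2 * (z0 j - cnj (u j)))"
        by (simp add: norm_mult)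
      also have "\<dots> \<le> \<delta> * (7 + 4 * cmod (z0 j) + 6 * (d j)\<^sup>2)"
        using zj * \<delta> by (intro mult_mono) auto
      finally show ?thesis .
    qed
    have eq: "4 * (rho2 n z u - rho2 n z0 u)
        = (\<Sum>j<n - 1. (z j - cnj (u j))\<^sup>2 - (z0 j - cnj (u j))\<^sup>2) - 2 * \<i> * (z (n - 1) - z0 (n - 1))"
      by (simp add: rho2_def sum_subtractf algebra_simps)
    have "4 * cmod (rho2 n z u - rho2 n z0 u) = cmod (4 * (rho2 n z u - rho2 n z0 u))"
      by (simp only: norm_mult) simp
    also have "\<dots> \<le> cmod (\<Sum>j<n - 1. (z j - cnj (u j))\<^sup>2 - (z0 j - cnj (u j))\<^sup>2) + cmod (2 * \<i> * (z (n - 1) - z0 (n - 1)))"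
      unfolding eq by (rule norm_triangle_ineq4)
    also have "\<dots> \<le> (\<Sum>j<n - 1. \<delta> * (7 + 4 * cmod (z0 j) + 6 * (d j)\<^sup>2)) + 2 * \<delta>"
    proof (intro add_mono)
      show "cmod (\<Sum>j<n - 1. (z j - cnj (u j))\<^sup>2 - (z0 j - cnj (u j))\<^sup>2) \<le> (\<Sum>j<n - 1. \<delta> * (7 + 4 * cmod (z0 j) + 6 * (d j)\<^sup>2))"
        using step by (intro sum_norm_le) auto
      show "cmod (2 * \<i> * (z (n - 1) - z0 (n - 1))) \<le> 2 * \<delta>"
        using z n by (simp add: near_def norm_mult less_imp_le)
    qed
    also have "\<dots> = \<delta> * (A + 6 * (\<Sum>j<n - 1. (d j)\<^sup>2))"
      by (simp add: A_def sum.distrib sum_distrib_left algebra_simps)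
    also have "\<dots> \<le> \<delta> * (4 * M * R)"
    proof (rule mult_left_mono)
      have "A \<le> 2 * A / rho n z0 * R"
      proof -
        have "rho n z0 \<le> 2 * R" using R dsum u by (simp add: field_simps)
        then have "A * rho n z0 \<le> A * (2 * R)" using A by simp
        then show ?thesis using z0 by (simp add: field_simps)
      qed
      moreover have "6 * (\<Sum>j<n - 1. (d j)\<^sup>2) \<le> 24 * R" using R z0 u by simp
      moreover have "4 * M * R = 2 * A / rho n z0 * R + 24 * R"
        by (simp add: M_def distrib_right)
      ultimately show "A + 6 * (\<Sum>j<n - 1. (d j)\<^sup>2) \<le> 4 * M * R"
        by linarith
    qed (use \<delta> in auto)
    finally have "cmod (rho2 n z u - rho2 n z0 u) \<le> \<delta> * M * R" by simp
    also have "\<dots> \<le> \<epsilon> * R"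
      using \<delta> Re_rho2_pos[OF z0 u] by (intro mult_right_mono) (auto simp: R_def)
    also have "\<dots> \<le> \<epsilon> * cmod (rho2 n z0 u)"
      using \<epsilon> unfolding R_def by (intro mult_left_mono complex_Re_le_cmod) auto
    finally show ?thesis .
  qed
  with \<delta> that show ?thesis by blast
qed

text \<open>The quotient q of \<rho>(z,u) by \<rho>(z0,u) is close to 1 uniformly in u, and s is the
  power -c of q, close to 1 by continuity.\<close>

lemma rho2_powr_close:
  fixes c :: real
  assumes z0: "rho n z0 > 0"
  obtains \<delta> where "\<delta> > 0"
    "\<And>z u. near \<delta> z0 z \<Longrightarrow> rho n u > 0 \<Longrightarrow>
      \<exists>s. 1 / rho2 n z u powr c = s / rho2 n z0 u powr c \<and> cmod (s - 1) \<le> 1/4"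
proof -
  have "((\<lambda>q. inverse (q powr complex_of_real c)) \<longlongrightarrow> inverse (1 powr complex_of_real c)) (nhds 1)"
    by (intro tendsto_inverse tendsto_powr_complex filterlim_ident tendsto_const) (auto simp: complex_nonpos_Reals_iff)
  then have "\<forall>\<^sub>F q in nhds 1. dist (inverse (q powr complex_of_real c)) 1 < 1/4"
    by (auto dest!: tendstoD[where e="1/4"])
  then obtain e where e: "e > 0" "\<And>q. dist q 1 < e \<Longrightarrow> dist (inverse (q powr complex_of_real c)) 1 < 1/4"
    unfolding eventually_nhds_metric by blast
  define \<epsilon> where "\<epsilon> = min (e/2) (1/2)"
  have \<epsilon>: "\<epsilon> > 0" "\<epsilon> < e" "\<epsilon> < 1" using e by (auto simp: \<epsilon>_def)
  obtain \<delta> where \<delta>: "\<delta> > 0" "\<And>z u. near \<delta> z0 z \<Longrightarrow> rho n u > 0 \<Longrightarrow> cmod (rho2 n z u - rho2 n z0 u) \<le> \<epsilon> * cmod (rho2 n z0 u)"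
    using rho2_close[OF z0 \<epsilon>(1)] by blast
  have "\<exists>s. 1 / rho2 n z u powr c = s / rho2 n z0 u powr c \<and> cmod (s - 1) \<le> 1/4"
    if "near \<delta> z0 z" "rho n u > 0" for z u
  proof -
    let ?A = "rho2 n z0 u"
    have A: "Re ?A > 0" "?A \<noteq> 0" using Re_rho2_pos[OF z0 that(2)] rho2_nonzero[OF z0 that(2)] by auto
    define q where "q = rho2 n z u / ?A"
    have "q - 1 = (rho2 n z u - ?A) / ?A" using A by (simp add: q_def diff_divide_distrib)
    then have "cmod (q - 1) \<le> \<epsilon>"
      using \<delta>(2)[OF that] A by (simp add: norm_divide divide_le_eq)
    then have q: "cmod (q - 1) < e" "cmod (q - 1) < 1" using \<epsilon> by auto
    then have Req: "Re q > 0" using abs_Re_le_cmod[of "q - 1"] by simp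
    then have q0: "q \<noteq> 0" by auto
    \<comment> \<open>Both factors lie in the right half plane, so their arguments add up to less
      than \<pi> in modulus and the principal logarithm is additive.\<close>
    have "Ln (?A * q) = Ln ?A + Ln q"
      using A q0 Re_Ln_pos_lt_imp[OF A(1)] Re_Ln_pos_lt_imp[OF Req] by (intro Ln_times_simple) auto
    then have "(?A * q) powr complex_of_real c = ?A powr c * q powr c"
      using A q0 by (simp add: powr_def exp_add ring_distribs)
    moreover have "?A * q = rho2 n z u" using A by (simp add: q_def)
    ultimately have "1 / rho2 n z u powr c = inverse (q powr c) / ?A powr c"
      by (simp add: field_simps)
    moreover have "cmod (inverse (q powr c) - 1) \<le> 1/4"
      using e(2)[of q] q by (simp add: dist_norm)
    ultimately show ?thesis by blast
  qed
  with \<delta>(1) that show ?thesis by blast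
qed

text \<open>A lower bound on the real part of the ratio is what rules out cancellation when the
  kernel at (z,w) is integrated against the conjugate phase of the kernel at (z0,w0).\<close>

lemma kerT_close:
  assumes "rho n z0 > 0" "rho n w0 > 0"
  obtains \<delta> where "\<delta> > 0"
    "\<And>z w u \<eta>. near \<delta> z0 z \<Longrightarrow> near \<delta> w0 w \<Longrightarrow> rho n u > 0 \<Longrightarrow> rho n \<eta> > 0 \<Longrightarrow>
      \<exists>s. kerT n b1 b2 c1 c2 z w u \<eta> = s * kerT n b1 b2 c1 c2 z0 w0 u \<eta> \<and> Re s \<ge> 1/4"
proof -
  obtain \<delta>1 where \<delta>1: "\<delta>1 > 0" "\<And>z u. near \<delta>1 z0 z \<Longrightarrow> rho n u > 0 \<Longrightarrow>
      \<exists>s. 1 / rho2 n z u powr c1 = s / rho2 n z0 u powr c1 \<and> cmod (s - 1) \<le> 1/4"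
    using rho2_powr_close[OF assms(1), of c1] by blast
  obtain \<delta>2 where \<delta>2: "\<delta>2 > 0" "\<And>z u. near \<delta>2 w0 z \<Longrightarrow> rho n u > 0 \<Longrightarrow>
      \<exists>s. 1 / rho2 n z u powr c2 = s / rho2 n w0 u powr c2 \<and> cmod (s - 1) \<le> 1/4"
    using rho2_powr_close[OF assms(2), of c2] by blast
  have "\<exists>s. kerT n b1 b2 c1 c2 z w u \<eta> = s * kerT n b1 b2 c1 c2 z0 w0 u \<eta> \<and> Re s \<ge> 1/4"
    if near: "near (min \<delta>1 \<delta>2) z0 z" "near (min \<delta>1 \<delta>2) w0 w" "rho n u > 0" "rho n \<eta> > 0" for z w u \<eta>
  proof -
    have "near \<delta>1 z0 z" "near \<delta>2 w0 w"
      using near_mono[OF near(1)] near_mono[OF near(2)] by auto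
    then obtain s t where s: "1 / rho2 n z u powr c1 = s / rho2 n z0 u powr c1" "cmod (s - 1) \<le> 1/4"
      and t: "1 / rho2 n w \<eta> powr c2 = t / rho2 n w0 \<eta> powr c2" "cmod (t - 1) \<le> 1/4"
      using \<delta>1(2)[of z u] \<delta>2(2)[of w \<eta>] near(3,4) by blast
    have fact: "kerT n b1 b2 c1 c2 z w u \<eta> = complex_of_real (rho n u powr b1 * rho n \<eta> powr b2)
        * (1 / rho2 n z u powr c1) * (1 / rho2 n w \<eta> powr c2)" for z w
      by (simp add: kerT_def)
    have eq: "kerT n b1 b2 c1 c2 z w u \<eta> = (s * t) * kerT n b1 b2 c1 c2 z0 w0 u \<eta>"
      unfolding fact[of z w] fact[of z0 w0] s(1) t(1) by simp
    \<comment> \<open>Two factors within 1/4 of 1 have a product within 9/16 of 1, so its real part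
      is at least 7/16.\<close>
    have "cmod (s * t - 1) = cmod ((s - 1) * (t - 1) + (s - 1) + (t - 1))"
      by (simp add: algebra_simps)
    also have "\<dots> \<le> cmod (s - 1) * cmod (t - 1) + cmod (s - 1) + cmod (t - 1)"
      using norm_triangle_ineq[of "(s - 1) * (t - 1) + (s - 1)" "t - 1"] norm_triangle_ineq[of "(s - 1) * (t - 1)" "s - 1"]
      by (simp add: norm_mult)
    also have "\<dots> \<le> 1/4 * (1/4) + 1/4 + 1/4"
      using s(2) t(2) by (intro add_mono mult_mono) auto
    finally have "Re (s * t) \<ge> 1/4" using abs_Re_le_cmod[of "s * t - 1"] by simp
    with eq show ?thesis by blast
  qed
  with that[of "min \<delta>1 \<delta>2"] \<delta>1(1) \<delta>2(1) show ?thesis by auto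
qed

end

section \<open>Boundedness of the integral operators\<close>

text \<open>Young's inequality with constants 1. On either side of the curve x = y^(q - 1) one of
  the two summands alone dominates the product.\<close>

lemma young_crude:
  fixes x y p q :: real
  assumes "x \<ge> 0" "y \<ge> 0" "p > 1" "q = p / (p - 1)"
  shows "x * y \<le> x powr p + y powr q"
proof (cases "x = 0 \<or> y = 0")
  case False
  then have xy: "x > 0" "y > 0" using assms by auto
  have q: "q - 1 = 1 / (p - 1)" using assms by (simp add: field_simps)
  show ?thesis
  proof (cases "x \<le> y powr (q - 1)")
    case True
    then have "x * y \<le> y powr (q - 1) * y" using xy by simp
    also have "\<dots> = y powr q" using xy by (simp add: powr_diff)
    finally show ?thesis using xy by (smt (verit) powr_gt_zero)
  next
    case False
    have "y = (y powr (q - 1)) powr (p - 1)"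
      using xy q assms by (simp add: powr_powr)
    also have "\<dots> \<le> x powr (p - 1)"
      using False assms by (intro powr_mono2) auto
    finally have "x * y \<le> x * x powr (p - 1)" using xy by simp
    also have "\<dots> = x powr p" using xy by (simp add: powr_diff)
    finally show ?thesis using xy by (smt (verit) powr_gt_zero)
  qed
qed (use assms in auto)

context tube begin

abbreviation weight :: "real \<Rightarrow> real \<Rightarrow> (nat \<Rightarrow> complex) \<Rightarrow> (nat \<Rightarrow> complex) \<Rightarrow> real" where
  "weight b c z u \<equiv> rho n u powr b * cmod (rho2 n z u) powr (- c)"

lemma TB_rho_exists:
  assumes "r > 0" obtains z where "z \<in> TB n" "rho n z = r"
proof -
  define z where "z = restrict (\<lambda>j. if j = n - 1 then \<i> * of_real r else 0) {..<n}"
  have "rho n z = r" using n by (auto simp: rho_def z_def intro!: sum.neutral)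
  moreover have "z \<in> space (Cn n)" by (auto simp: z_def Cn_def space_PiM)
  ultimately show ?thesis using that assms by (auto simp: TB_def)
qed

lemma TB_D: "z \<in> TB n \<Longrightarrow> z \<in> space (Cn n)" "z \<in> TB n \<Longrightarrow> rho n z > 0"
  by (auto simp: TB_def)

text \<open>By \<open>forelli_rudin_eq\<close> the bounded quantity is a positive constant times
  r^e, where r = \<rho>(z) takes every positive value. The value r = 1 shows that the constant is
  finite, which gives b > -1 and c > n + 1 + b. Boundedness over all r forces e = 0, and a > 0
  follows.\<close>

lemma bounded_forelli_rudin:
  assumes D: "D < \<infinity>" and bound: "\<And>z. z \<in> TB n \<Longrightarrow> ennreal (rho n z powr a) * forelli_rudin n b c z \<le> D"
  shows "a > 0 \<and> b > -1 \<and> c = real n + 1 + a + b"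
proof -
  define e where "e = a + (real n + 1 + b - c)"
  have le: "ennreal (r powr e) * forelli_rudin_const n b c \<le> D" if r: "r > 0" for r
  proof -
    obtain z where "z \<in> TB n" "rho n z = r" using TB_rho_exists[OF r] by blast
    then show ?thesis using bound[of z] r
      by (simp add: forelli_rudin_eq e_def powr_add ennreal_mult mult.assoc)
  qed
  have fin: "forelli_rudin_const n b c < \<infinity>" using le[of 1] D by (simp add: order.strict_trans1)
  then obtain k where k: "forelli_rudin_const n b c = ennreal k" "k \<ge> 0"
    by (cases "forelli_rudin_const n b c") auto
  obtain d where d: "D = ennreal d" "d \<ge> 0" using D by (cases D) auto
  have kpos: "k > 0" using forelli_rudin_const_pos[of n b c] k by simp
  have le': "r powr e \<le> d / k" if "r > 0" for r
    using le[OF that] k d kpos by (simp add: ennreal_mult[symmetric] field_simps)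
  have "e = 0"
  proof (rule ccontr)
    assume "e \<noteq> 0"
    \<comment> \<open>This r is chosen so that r^e = d/k + 1 exceeds the bound d/k, whatever the
      sign of e.\<close>
    have "((d / k + 1) powr (1 / e)) powr e = d / k + 1"
      using \<open>e \<noteq> 0\<close> d kpos by (simp add: powr_powr add_nonneg_pos)
    moreover have "(d / k + 1) powr (1 / e) > 0"
      using d kpos by (simp add: add_nonneg_eq_0_iff)
    ultimately show False using le'[of "(d / k + 1) powr (1 / e)"] by simp
  qed
  with fin show ?thesis
    using forelli_rudin_const_finite[OF n, of b c] by (auto simp: e_def)
qed

lemma mixed_norm_inf_inf_le:
  assumes [measurable]: "g \<in> borel_measurable (Cn n \<Otimes>\<^sub>M Cn n)"
    and "\<And>z w. z \<in> TB n \<Longrightarrow> w \<in> TB n \<Longrightarrow> ennreal (cmod (g (z, w))) \<le> D"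
  shows "mixed_norm_inf_inf n g \<le> D"
  unfolding mixed_norm_inf_inf_def
proof (rule esssup_I)
  have "(\<lambda>x. ennreal (cmod (g x))) \<in> borel_measurable (dV n 0 \<Otimes>\<^sub>M dV n 0)" by measurable
  from borel_measurable_esssup[OF sigma_finite_dV this]
  show "(\<lambda>w. esssup (dV n 0) (\<lambda>z. ennreal (cmod (g (z, w))))) \<in> borel_measurable (dV n 0)" .
  have "esssup (dV n 0) (\<lambda>z. ennreal (cmod (g (z, w)))) \<le> D" if w: "w \<in> TB n" for w
  proof (rule esssup_I)
    have [measurable]: "w \<in> space (Cn n)" using w by (rule TB_D)
    show "(\<lambda>z. ennreal (cmod (g (z, w)))) \<in> borel_measurable (dV n 0)" by measurable
    show "AE z in dV n 0. ennreal (cmod (g (z, w))) \<le> D"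
      unfolding AE_dV_iff using assms(2) w by simp
  qed
  then show "AE w in dV n 0. esssup (dV n 0) (\<lambda>z. ennreal (cmod (g (z, w)))) \<le> D"
    unfolding AE_dV_iff by simp
qed

lemma weight_measurable:
  assumes "z \<in> space (Cn n)"
  shows "weight b c z \<in> borel_measurable (Cn n)"
  using assms by measurable

lemma nn_integral_weight_product:
  assumes z: "z \<in> space (Cn n)" and [measurable]: "h \<in> borel_measurable (Cn n)"
  shows "(\<integral>\<^sup>+x. ennreal (weight b c z (fst x)) * h (snd x) \<partial>(dV n 0 \<Otimes>\<^sub>M dV n 0))
    = forelli_rudin n b c z * (\<integral>\<^sup>+\<eta>. h \<eta> \<partial>dV n 0)"
proof -
  note weight_measurable[OF z, measurable]
  have "(\<integral>\<^sup>+x. ennreal (weight b c z (fst x)) * h (snd x) \<partial>(dV n 0 \<Otimes>\<^sub>M dV n 0))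
     = (\<integral>\<^sup>+\<eta>. \<integral>\<^sup>+u. ennreal (weight b c z u) * h \<eta> \<partial>dV n 0 \<partial>dV n 0)"
    by (subst dV0.nn_integral_snd[symmetric]) auto
  also have "\<dots> = (\<integral>\<^sup>+\<eta>. forelli_rudin n b c z * h \<eta> \<partial>dV n 0)"
    unfolding forelli_rudin_def by (intro nn_integral_cong nn_integral_multc) auto
  also have "\<dots> = forelli_rudin n b c z * (\<integral>\<^sup>+\<eta>. h \<eta> \<partial>dV n 0)"
    by (intro nn_integral_cmult) auto
  finally show ?thesis .
qed

end

text \<open>These three properties are all that the boundedness argument uses of a kernel. They hold
  for both \<open>kerS\<close> and \<open>kerT\<close>, so the two equivalences are proved
  once.\<close>

locale kernel = tube +
  fixes K :: "(nat \<Rightarrow> complex) \<Rightarrow> (nat \<Rightarrow> complex) \<Rightarrow> (nat \<Rightarrow> complex) \<Rightarrow> (nat \<Rightarrow> complex) \<Rightarrow> complex"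
    and b1 b2 c1 c2 :: real
  assumes K_measurable: "(\<lambda>x. K (fst (fst x)) (snd (fst x)) (fst (snd x)) (snd (snd x)))
      \<in> borel_measurable ((Cn n \<Otimes>\<^sub>M Cn n) \<Otimes>\<^sub>M (Cn n \<Otimes>\<^sub>M Cn n))"
    and norm_K: "cmod (K z w u \<eta>) = weight b1 c1 z u * weight b2 c2 w \<eta>"
    and K_close: "rho n z0 > 0 \<Longrightarrow> rho n w0 > 0 \<Longrightarrow>
      \<exists>\<delta>>0. \<forall>z w u \<eta>. near \<delta> z0 z \<longrightarrow> near \<delta> w0 w \<longrightarrow> rho n u > 0 \<longrightarrow> rho n \<eta> > 0 \<longrightarrow>
        (\<exists>s. K z w u \<eta> = s * K z0 w0 u \<eta> \<and> Re s \<ge> 1/4)"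
begin

lemma K_section_measurable:
  assumes z: "z \<in> space (Cn n)" and w: "w \<in> space (Cn n)"
  shows "(\<lambda>y. K z w (fst y) (snd y)) \<in> borel_measurable (Cn n \<Otimes>\<^sub>M Cn n)"
proof -
  have "Pair (z, w) \<in> (Cn n \<Otimes>\<^sub>M Cn n) \<rightarrow>\<^sub>M ((Cn n \<Otimes>\<^sub>M Cn n) \<Otimes>\<^sub>M (Cn n \<Otimes>\<^sub>M Cn n))"
    using z w by (intro measurable_Pair1') (auto simp: space_pair_measure)
  from measurable_compose[OF this K_measurable] show ?thesis by simp
qed

lemma op_int_measurable:
  assumes [measurable]: "f \<in> borel_measurable (Cn n \<Otimes>\<^sub>M Cn n)"
  shows "op_int n a1 a2 K f \<in> borel_measurable (Cn n \<Otimes>\<^sub>M Cn n)"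
proof -
  note K_measurable[measurable]
  have "sigma_finite_measure (dV n 0 \<Otimes>\<^sub>M dV n 0)"
    by (intro sigma_finite_pair_measure sigma_finite_dV)
  then have "(\<lambda>x. \<integral>y. K (fst x) (snd x) (fst y) (snd y) * f y \<partial>(dV n 0 \<Otimes>\<^sub>M dV n 0)) \<in> borel_measurable (Cn n \<Otimes>\<^sub>M Cn n)"
    by (rule sigma_finite_measure.borel_measurable_lebesgue_integral)
       (simp add: case_prod_beta', measurable)
  then have "(\<lambda>x. complex_of_real (rho n (fst x) powr a1 * rho n (snd x) powr a2) *
      (\<integral>y. K (fst x) (snd x) (fst y) (snd y) * f y \<partial>(dV n 0 \<Otimes>\<^sub>M dV n 0))) \<in> borel_measurable (Cn n \<Otimes>\<^sub>M Cn n)"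
    by measurable
  then show ?thesis by (simp add: op_int_def case_prod_beta')
qed

text \<open>At almost every (z,w) near (z0,w0) the operator bound holds for f, the conjugate phase
  of the kernel at (z0,w0) times g. There the real part of the integrand is at least a quarter of
  the positive integrand at (z0,w0), so the bound passes to the positive integral. The constant is
  independent of z0, w0 and g, although the radius is not.\<close>

lemma bounded_imp_test_inequality:
  assumes p: "p2 > 1" and bounded: "bounded_inf_p_to_inf n p2 \<alpha>1 \<alpha>2 a1 a2 K"
  shows "\<exists>C\<ge>0. \<forall>z0\<in>TB n. \<forall>w0\<in>TB n. \<forall>g\<in>borel_measurable (Cn n). \<forall>X\<ge>0. (\<forall>\<eta>. g \<eta> \<ge> 0) \<longrightarrow>
      (\<integral>\<^sup>+\<eta>. ennreal (g \<eta> powr p2) \<partial>dV n \<alpha>2) = ennreal X \<longrightarrow>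
      ennreal (rho n z0 powr a1 * rho n w0 powr a2) * (forelli_rudin n b1 c1 z0 * (\<integral>\<^sup>+\<eta>. ennreal (weight b2 c2 w0 \<eta> * g \<eta>) \<partial>dV n 0))
        \<le> ennreal (C * X powr (1 / p2))"
proof -
  let ?MM = "dV n 0 \<Otimes>\<^sub>M dV n 0"
  obtain C where C: "C \<ge> 0" and CB: "\<And>f. f \<in> borel_measurable (Cn n \<Otimes>\<^sub>M Cn n) \<Longrightarrow> mixed_norm_inf_p n p2 \<alpha>1 \<alpha>2 f < \<infinity> \<Longrightarrow>
      (AE x in ?MM. integrable ?MM (\<lambda>(u, \<eta>). K (fst x) (snd x) u \<eta> * f (u, \<eta>))) \<and>
            mixed_norm_inf_inf n (op_int n a1 a2 K f) \<le> ennreal C * mixed_norm_inf_p n p2 \<alpha>1 \<alpha>2 f"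
    using bounded unfolding bounded_inf_p_to_inf_def by blast
  have "ennreal (rho n z0 powr a1 * rho n w0 powr a2) * (forelli_rudin n b1 c1 z0 * (\<integral>\<^sup>+\<eta>. ennreal (weight b2 c2 w0 \<eta> * g \<eta>) \<partial>dV n 0))
        \<le> ennreal (16 * C * X powr (1 / p2))"
    if z0: "z0 \<in> TB n" and w0: "w0 \<in> TB n" and g[measurable]: "g \<in> borel_measurable (Cn n)" and g0: "\<And>\<eta>. g \<eta> \<ge> 0"
      and X: "X \<ge> 0" "(\<integral>\<^sup>+\<eta>. ennreal (g \<eta> powr p2) \<partial>dV n \<alpha>2) = ennreal X"
    for z0 w0 g X
  proof -
    note K0[measurable] = K_section_measurable[OF TB_D(1)[OF z0] TB_D(1)[OF w0]]
    have [measurable]: "cnj \<in> borel_measurable borel"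
      by (intro borel_measurable_continuous_onI continuous_intros)
    \<comment> \<open>Where the kernel vanishes the quotient is 0 by convention; the claimed lower
      bound for the integrand is 0 there as well.\<close>
    define f where "f y = cnj (K z0 w0 (fst y) (snd y)) / cmod (K z0 w0 (fst y) (snd y)) * g (snd y)" for y
    have f[measurable]: "f \<in> borel_measurable (Cn n \<Otimes>\<^sub>M Cn n)"
      unfolding f_def by measurable
    have f_le: "cmod (f y) \<le> g (snd y)" for y
      using g0 by (simp add: f_def norm_mult norm_divide)
    have "mixed_norm_inf_p n p2 \<alpha>1 \<alpha>2 f \<le> enn_powr (ennreal X) (1 / p2)"
      unfolding mixed_norm_inf_p_def X(2)[symmetric]
    proof (intro enn_powr_mono nn_integral_mono)
      fix \<eta> assume "\<eta> \<in> space (dV n \<alpha>2)"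
      then have [measurable]: "\<eta> \<in> space (Cn n)" by simp
      have "esssup (dV n \<alpha>1) (\<lambda>z. ennreal (cmod (f (z, \<eta>)))) \<le> ennreal (g \<eta>)"
      proof (intro esssup_I AE_I2 ennreal_leI)
        show "(\<lambda>z. ennreal (cmod (f (z, \<eta>)))) \<in> borel_measurable (dV n \<alpha>1)" by measurable
        show "cmod (f (z, \<eta>)) \<le> g \<eta>" for z using f_le[of "(z, \<eta>)"] by simp
      qed
      then have "enn_powr (esssup (dV n \<alpha>1) (\<lambda>z. ennreal (cmod (f (z, \<eta>))))) p2 \<le> enn_powr (ennreal (g \<eta>)) p2"
        using p by (intro enn_powr_mono) auto
      then show "enn_powr (esssup (dV n \<alpha>1) (\<lambda>z. ennreal (cmod (f (z, \<eta>))))) p2 \<le> ennreal (g \<eta> powr p2)"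
        using g0 by (simp add: enn_powr_ennreal)
    qed (use p in auto)
    then have norm_f: "mixed_norm_inf_p n p2 \<alpha>1 \<alpha>2 f \<le> ennreal (X powr (1 / p2))"
      using X by (simp add: enn_powr_ennreal)
    then have "mixed_norm_inf_p n p2 \<alpha>1 \<alpha>2 f < \<infinity>"
      by (rule order.strict_trans1) simp
    from CB[OF f this] have
      int: "AE x in ?MM. integrable ?MM (\<lambda>(u, \<eta>). K (fst x) (snd x) u \<eta> * f (u, \<eta>))" and
      bd: "mixed_norm_inf_inf n (op_int n a1 a2 K f) \<le> ennreal C * mixed_norm_inf_p n p2 \<alpha>1 \<alpha>2 f" by auto
    have "mixed_norm_inf_inf n (op_int n a1 a2 K f) \<le> ennreal C * ennreal (X powr (1 / p2))"
      using bd norm_f by (meson mult_left_mono order_trans zero_le)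
    then have bd': "mixed_norm_inf_inf n (op_int n a1 a2 K f) \<le> ennreal (C * X powr (1 / p2))"
      using C by (simp add: ennreal_mult)
    have "AE w in dV n 0. esssup (dV n 0) (\<lambda>z. ennreal (cmod (op_int n a1 a2 K f (z, w)))) \<le> ennreal (C * X powr (1 / p2))"
      using esssup_AE[of "\<lambda>w. esssup (dV n 0) (\<lambda>z. ennreal (cmod (op_int n a1 a2 K f (z, w))))" "dV n 0"]
      by eventually_elim (erule order_trans[OF _ bd'[unfolded mixed_norm_inf_inf_def]])
    then have "AE w in dV n 0. AE z in dV n 0. ennreal (cmod (op_int n a1 a2 K f (z, w))) \<le> ennreal (C * X powr (1 / p2))"
    proof eventually_elim
      case (elim w)
      from esssup_AE[of "\<lambda>z. ennreal (cmod (op_int n a1 a2 K f (z, w)))" "dV n 0"] show ?case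
        by eventually_elim (erule order_trans[OF _ elim])
    qed
    moreover have "AE w in dV n 0. AE z in dV n 0. integrable ?MM (\<lambda>(u, \<eta>). K z w u \<eta> * f (u, \<eta>))"
      using AE_pair_swap[OF int] by simp
    ultimately have good: "AE w in dV n 0. AE z in dV n 0. ennreal (cmod (op_int n a1 a2 K f (z, w))) \<le> ennreal (C * X powr (1 / p2))
        \<and> integrable ?MM (\<lambda>(u, \<eta>). K z w u \<eta> * f (u, \<eta>))"
      by eventually_elim simp
    obtain \<delta>1 where \<delta>1: "\<delta>1 > 0" "\<And>z w u \<eta>. near \<delta>1 z0 z \<Longrightarrow> near \<delta>1 w0 w \<Longrightarrow> rho n u > 0 \<Longrightarrow> rho n \<eta> > 0 \<Longrightarrow>
        (\<exists>s. K z w u \<eta> = s * K z0 w0 u \<eta> \<and> Re s \<ge> 1/4)"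
      using K_close[OF TB_D(2)[OF z0] TB_D(2)[OF w0]] by blast
    obtain \<delta>2 where \<delta>2: "\<delta>2 > 0" "\<And>z. near \<delta>2 z0 z \<Longrightarrow> rho n z > 0 \<and> rho n z0 powr a1 \<le> 2 * rho n z powr a1"
      using rho_powr_close[OF TB_D(2)[OF z0], of a1] by blast
    obtain \<delta>3 where \<delta>3: "\<delta>3 > 0" "\<And>z. near \<delta>3 w0 z \<Longrightarrow> rho n z > 0 \<and> rho n w0 powr a2 \<le> 2 * rho n z powr a2"
      using rho_powr_close[OF TB_D(2)[OF w0], of a2] by blast
    define \<delta> where "\<delta> = min \<delta>1 (min \<delta>2 \<delta>3)"
    have \<delta>: "\<delta> > 0" "\<delta> \<le> \<delta>1" "\<delta> \<le> \<delta>2" "\<delta> \<le> \<delta>3" using \<delta>1 \<delta>2 \<delta>3 by (auto simp: \<delta>_def)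
    \<comment> \<open>The almost everywhere statements are nested, so w is chosen first and z
      afterwards, from a null set that depends on w.\<close>
    obtain w where w: "w \<in> TB n" "near \<delta> w0 w" and
      good_w: "AE z in dV n 0. ennreal (cmod (op_int n a1 a2 K f (z, w))) \<le> ennreal (C * X powr (1 / p2))
        \<and> integrable ?MM (\<lambda>(u, \<eta>). K z w u \<eta> * f (u, \<eta>))"
      using AE_dV_imp_near[OF \<delta>(1) w0 good] by blast
    obtain z where z: "z \<in> TB n" "near \<delta> z0 z" and
      bd_z: "ennreal (cmod (op_int n a1 a2 K f (z, w))) \<le> ennreal (C * X powr (1 / p2))" and
      int_z: "integrable ?MM (\<lambda>(u, \<eta>). K z w u \<eta> * f (u, \<eta>))"
      using AE_dV_imp_near[OF \<delta>(1) z0 good_w] by blast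
    define F where "F y = K z w (fst y) (snd y) * f y" for y
    have F_int: "integrable ?MM F" using int_z by (simp add: F_def[abs_def] case_prod_beta')
    have Re_F: "Re (F y) \<ge> 1/4 * (cmod (K z0 w0 (fst y) (snd y)) * g (snd y))"
      if y: "fst y \<in> TB n \<and> snd y \<in> TB n" for y
    proof -
      obtain s where s: "K z w (fst y) (snd y) = s * K z0 w0 (fst y) (snd y)" "Re s \<ge> 1/4"
        using \<delta>1(2)[of z w "fst y" "snd y"] near_mono[OF z(2) \<delta>(2)] near_mono[OF w(2) \<delta>(2)] y
        by (auto simp: TB_def)
      let ?k = "K z0 w0 (fst y) (snd y)"
      have "F y = s * (?k * cnj ?k / cmod ?k) * g (snd y)"
        by (simp add: F_def f_def s(1))
      also have "?k * cnj ?k / cmod ?k = cmod ?k"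
        by (cases "?k = 0") (simp_all add: complex_norm_square[symmetric] power2_eq_square)
      finally have "Re (F y) = Re s * (cmod ?k * g (snd y))" by simp
      also have "\<dots> \<ge> 1/4 * (cmod ?k * g (snd y))"
        using s(2) g0 by (intro mult_right_mono) auto
      finally show ?thesis .
    qed
    have "ennreal (1/4) * (\<integral>\<^sup>+y. ennreal (cmod (K z0 w0 (fst y) (snd y)) * g (snd y)) \<partial>?MM)
      = (\<integral>\<^sup>+y. ennreal (1/4 * (cmod (K z0 w0 (fst y) (snd y)) * g (snd y))) \<partial>?MM)"
      using g0 by (subst nn_integral_cmult[symmetric]) (auto simp: ennreal_mult[symmetric])
    also have "\<dots> \<le> (\<integral>\<^sup>+y. ennreal (Re (F y)) \<partial>?MM)"
      by (intro nn_integral_mono_AE, rule AE_mp[OF AE_dV0_pair], intro AE_I2 impI ennreal_leI Re_F)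
    also have "\<dots> = ennreal (\<integral>y. Re (F y) \<partial>?MM)"
    proof (rule nn_integral_eq_integral)
      show "integrable ?MM (\<lambda>y. Re (F y))" using F_int by (rule integrable_Re)
      show "AE y in ?MM. 0 \<le> Re (F y)"
      proof (rule AE_mp[OF AE_dV0_pair], intro AE_I2 impI)
        fix y assume "fst y \<in> TB n \<and> snd y \<in> TB n"
        from Re_F[OF this] g0 show "0 \<le> Re (F y)"
          by (smt (verit) mult_nonneg_nonneg norm_ge_zero zero_le_divide_1_iff)
      qed
    qed
    also have "(\<integral>y. Re (F y) \<partial>?MM) = Re (\<integral>y. F y \<partial>?MM)"
      using F_int by (rule integral_Re)
    also have "ennreal \<dots> \<le> ennreal (cmod (\<integral>y. F y \<partial>?MM))"
      by (intro ennreal_leI complex_Re_le_cmod)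
    finally have lower: "ennreal (1/4) * (\<integral>\<^sup>+y. ennreal (cmod (K z0 w0 (fst y) (snd y)) * g (snd y)) \<partial>?MM)
        \<le> ennreal (cmod (\<integral>y. F y \<partial>?MM))" .
    have "(\<integral>\<^sup>+y. ennreal (cmod (K z0 w0 (fst y) (snd y)) * g (snd y)) \<partial>?MM)
      = (\<integral>\<^sup>+y. ennreal (weight b1 c1 z0 (fst y)) * ennreal (weight b2 c2 w0 (snd y) * g (snd y)) \<partial>?MM)"
      by (intro nn_integral_cong) (simp add: norm_K ennreal_mult[symmetric] g0 mult_ac)
    also have "\<dots> = forelli_rudin n b1 c1 z0 * (\<integral>\<^sup>+\<eta>. ennreal (weight b2 c2 w0 \<eta> * g \<eta>) \<partial>dV n 0)"
    proof (rule nn_integral_weight_product)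
      note weight_measurable[OF TB_D(1)[OF w0], measurable]
      show "(\<lambda>\<eta>. ennreal (weight b2 c2 w0 \<eta> * g \<eta>)) \<in> borel_measurable (Cn n)" by measurable
    qed (rule TB_D(1)[OF z0])
    finally have prod: "(\<integral>\<^sup>+y. ennreal (cmod (K z0 w0 (fst y) (snd y)) * g (snd y)) \<partial>?MM)
        = forelli_rudin n b1 c1 z0 * (\<integral>\<^sup>+\<eta>. ennreal (weight b2 c2 w0 \<eta> * g \<eta>) \<partial>dV n 0)" (is "?P = ?Q") .
    have "op_int n a1 a2 K f (z, w) = complex_of_real (rho n z powr a1 * rho n w powr a2) * (\<integral>y. F y \<partial>?MM)"
      by (simp add: op_int_def F_def[abs_def] case_prod_beta')
    then have norm_op: "cmod (op_int n a1 a2 K f (z, w)) = rho n z powr a1 * rho n w powr a2 * cmod (\<integral>y. F y \<partial>?MM)"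
      by (simp add: norm_mult)
    \<comment> \<open>Moving the two powers of \<open>rho\<close> to (z,w) costs 2 each, and the
      ratio bound 1/4 costs another 4; together they give the constant 16.\<close>
    have "rho n z0 powr a1 * rho n w0 powr a2 \<le> (2 * rho n z powr a1) * (2 * rho n w powr a2)"
      using \<delta>2(2)[OF near_mono[OF z(2) \<delta>(3)]] \<delta>3(2)[OF near_mono[OF w(2) \<delta>(4)]]
      by (intro mult_mono) auto
    then have "ennreal (rho n z0 powr a1 * rho n w0 powr a2) * ?Q \<le> ennreal (4 * (rho n z powr a1 * rho n w powr a2)) * ?Q"
      by (intro mult_right_mono ennreal_leI) (auto simp: mult_ac)
    also have "\<dots> = ennreal (16 * (rho n z powr a1 * rho n w powr a2)) * (ennreal (1/4) * ?P)"
      unfolding prod mult.assoc[symmetric] by (subst ennreal_mult[symmetric]) (auto simp: mult_ac)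
    also have "\<dots> \<le> ennreal (16 * (rho n z powr a1 * rho n w powr a2)) * ennreal (cmod (\<integral>y. F y \<partial>?MM))"
      by (intro mult_left_mono lower) simp
    also have "\<dots> = ennreal 16 * ennreal (cmod (op_int n a1 a2 K f (z, w)))"
      unfolding norm_op by (subst (1 2) ennreal_mult[symmetric]) (auto simp: mult_ac)
    also have "\<dots> \<le> ennreal 16 * ennreal (C * X powr (1 / p2))"
      by (intro mult_left_mono bd_z) simp
    also have "\<dots> = ennreal (16 * C * X powr (1 / p2))"
      using C by (subst ennreal_mult[symmetric]) (auto simp: mult_ac)
    finally show ?thesis .
  qed
  then show ?thesis using C by (intro exI[of _ "16 * C"]) simp
qed

end

text \<open>Exponent bookkeeping for Hoelder duality. Splitting off \<rho>^(\<alpha>/p) for the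
  weighted p-norm leaves \<rho>^(b - \<alpha>/p), whose q-th power is \<rho>^B. The last two claims
  turn the one-variable conditions on B and c q into the stated ones on b and c, with m = n +
  1.\<close>

lemma conjugate_exponent:
  fixes p q b \<alpha> B a m :: real
  assumes p: "p > 1" and q: "q = p / (p - 1)" and B: "B = (b - \<alpha> / p) * q"
  shows "q > 0" "(q - 1) * p = q" "1 - 1 / p = 1 / q"
    and "b + (b - \<alpha>) * (q - 1) = B" "\<alpha> + (b - \<alpha>) * q = B"
    and "B > -1 \<longleftrightarrow> p * (b + 1) > \<alpha> + 1"
    and "(m + a + b - (m + \<alpha>) / p) * q = m + a * q + B"
proof -
  have q1: "q - 1 = 1 / (p - 1)" using p unfolding q by (simp add: field_simps)
  have qp: "q / p = q - 1" using p unfolding q1 by (simp add: q)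
  have "B = b * q - \<alpha> * (q / p)" unfolding B by (simp add: algebra_simps)
  then have B': "B = b * q - \<alpha> * (q - 1)" unfolding qp .
  show "q > 0" using p by (simp add: q)
  show "(q - 1) * p = q" using p unfolding q1 by (simp add: q)
  show "1 - 1 / p = 1 / q" using p by (simp add: q diff_divide_distrib)
  show "b + (b - \<alpha>) * (q - 1) = B" "\<alpha> + (b - \<alpha>) * q = B"
    unfolding B' by (simp_all add: algebra_simps)
  have "B * (p - 1) = b * (q * (p - 1)) - \<alpha> * ((q - 1) * (p - 1))"
    unfolding B' by (simp add: algebra_simps)
  also have "\<dots> = p * b - \<alpha>" unfolding q1 using p by (simp add: q mult.commute)
  finally have "B * (p - 1) = p * b - \<alpha>" .
  moreover have "B > -1 \<longleftrightarrow> -1 * (p - 1) < B * (p - 1)" using p by (subst mult_less_cancel_right_pos) auto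
  ultimately show "B > -1 \<longleftrightarrow> p * (b + 1) > \<alpha> + 1" by (auto simp: algebra_simps)
  have "(m + a + b - (m + \<alpha>) / p) * q = (m + a + b) * q - (m + \<alpha>) * (q / p)"
    by (simp add: algebra_simps)
  then show "(m + a + b - (m + \<alpha>) / p) * q = m + a * q + B"
    unfolding qp B' by (simp add: algebra_simps)
qed

section \<open>Necessity and sufficiency of the parameter conditions\<close>

context kernel begin

text \<open>For the truncated Hoelder extremal function g, both the pairing with the kernel weight
  and the p-th power of the norm equal the same number x. The test inequality becomes a product of
  two one-variable factors, x against x^(1/p), and \<open>bounded_forelli_rudin\<close> applies to
  each factor in turn.\<close>

lemma bounded_imp_parameters:
  assumes p: "p2 > 1" and bounded: "bounded_inf_p_to_inf n p2 \<alpha>1 \<alpha>2 a1 a2 K"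
  shows "a1 > 0 \<and> a2 > 0 \<and> b1 > -1 \<and> p2 * (b2 + 1) > \<alpha>2 + 1
     \<and> c1 = real n + 1 + a1 + b1 \<and> c2 = real n + 1 + a2 + b2 - (real n + 1 + \<alpha>2) / p2"
proof -
  define q where "q = p2 / (p2 - 1)"
  define B where "B = (b2 - \<alpha>2 / p2) * q"
  note conj = conjugate_exponent[OF p q_def B_def]
  note q = conj(1-3) and B = conj(4,5)
  obtain C where C: "C \<ge> 0" and test: "\<forall>z0\<in>TB n. \<forall>w0\<in>TB n. \<forall>g\<in>borel_measurable (Cn n). \<forall>X\<ge>0. (\<forall>\<eta>. g \<eta> \<ge> 0) \<longrightarrow>
      (\<integral>\<^sup>+\<eta>. ennreal (g \<eta> powr p2) \<partial>dV n \<alpha>2) = ennreal X \<longrightarrow>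
      ennreal (rho n z0 powr a1 * rho n w0 powr a2) * (forelli_rudin n b1 c1 z0 * (\<integral>\<^sup>+\<eta>. ennreal (weight b2 c2 w0 \<eta> * g \<eta>) \<partial>dV n 0))
        \<le> ennreal (C * X powr (1 / p2))"
    using bounded_imp_test_inequality[OF p bounded] by blast
  \<comment> \<open>The integral of \<open>k\<close> may be infinite at this stage, while the test
    inequality asks for a finite norm. The numbers \<open>x N\<close> are its truncations, and their
    supremum recovers the full integral.\<close>
  have dual: "\<exists>x :: nat \<Rightarrow> real. (\<forall>N. x N \<ge> 0) \<and> (SUP N. ennreal (x N)) = forelli_rudin n B (c2 * q) w0 \<and>
      (\<forall>N. \<forall>z0\<in>TB n. ennreal (rho n z0 powr a1 * rho n w0 powr a2) * (forelli_rudin n b1 c1 z0 * ennreal (x N))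
        \<le> ennreal (C * x N powr (1 / p2)))" if w0: "w0 \<in> TB n" for w0
  proof -
    note [measurable] = TB_D(1)[OF w0]
    define k where "k = weight B (c2 * q) w0"
    have k[measurable]: "k \<in> borel_measurable (Cn n)" unfolding k_def by measurable
    \<comment> \<open>The density is finite-valued, so the measure is sigma-finite; this supplies an
      increasing exhaustion by sets over which \<open>k\<close> has finite integral.\<close>
    define \<nu> where "\<nu> = density (dV n 0) (\<lambda>\<eta>. ennreal (k \<eta>))"
    interpret \<nu>: sigma_finite_measure \<nu>
      unfolding \<nu>_def
      by (subst sigma_finite_measure.sigma_finite_iff_density_finite[OF sigma_finite_dV]) auto
    obtain A :: "nat \<Rightarrow> _" where A: "range A \<subseteq> sets \<nu>" "(\<Union>i. A i) = space \<nu>" "\<And>i. emeasure \<nu> (A i) \<noteq> \<infinity>" "incseq A"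
      using \<nu>.sigma_finite_incseq by blast
    have A_meas[measurable]: "A N \<in> sets (Cn n)" for N using A(1) by (auto simp: \<nu>_def)
    define x where "x N = enn2real (emeasure \<nu> (A N))" for N
    have x: "ennreal (x N) = emeasure \<nu> (A N)" for N
      using A(3)[of N] by (simp add: x_def less_top)
    have x_int: "ennreal (x N) = (\<integral>\<^sup>+\<eta>. ennreal (k \<eta> * indicator (A N) \<eta>) \<partial>dV n 0)" for N
    proof -
      have "emeasure \<nu> (A N) = (\<integral>\<^sup>+\<eta>. ennreal (k \<eta>) * indicator (A N) \<eta> \<partial>dV n 0)"
        unfolding \<nu>_def by (rule emeasure_density) auto
      also have "\<dots> = (\<integral>\<^sup>+\<eta>. ennreal (k \<eta> * indicator (A N) \<eta>) \<partial>dV n 0)"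
        by (intro nn_integral_cong) (auto simp: indicator_def)
      finally show ?thesis by (simp add: x)
    qed
    have "(SUP N. ennreal (x N)) = emeasure \<nu> (\<Union>i. A i)"
      unfolding x using A by (intro SUP_emeasure_incseq) auto
    also have "\<dots> = emeasure \<nu> (space \<nu>)" by (simp add: A)
    also have "\<dots> = forelli_rudin n B (c2 * q) w0"
      unfolding \<nu>_def forelli_rudin_def by (subst emeasure_density) (auto intro!: nn_integral_cong simp: k_def)
    finally have sup: "(SUP N. ennreal (x N)) = forelli_rudin n B (c2 * q) w0" .
    have "ennreal (rho n z0 powr a1 * rho n w0 powr a2) * (forelli_rudin n b1 c1 z0 * ennreal (x N))
        \<le> ennreal (C * x N powr (1 / p2))" if z0: "z0 \<in> TB n" for N z0
    proof -
      \<comment> \<open>This is the function giving equality in Hoelder's inequality: since (q - 1)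
        p = q, both \<open>weight b2 c2 w0 \<eta> * g \<eta>\<close> and \<rho>^\<alpha>2 g^p2
        reduce to \<open>k\<close> on \<open>A N\<close>.\<close>
      define g where "g \<eta> = rho n \<eta> powr ((b2 - \<alpha>2) * (q - 1)) * cmod (rho2 n w0 \<eta>) powr (- (c2 * (q - 1))) * indicator (A N) \<eta>" for \<eta>
      have [measurable]: "g \<in> borel_measurable (Cn n)" unfolding g_def by measurable
      have g1: "weight b2 c2 w0 \<eta> * g \<eta> = k \<eta> * indicator (A N) \<eta>" if "\<eta> \<in> TB n" for \<eta>
      proof -
        have "rho n \<eta> > 0" "cmod (rho2 n w0 \<eta>) > 0"
          using TB_D(2)[OF that] rho2_nonzero[OF TB_D(2)[OF w0] TB_D(2)[OF that]] by auto
        then have "weight b2 c2 w0 \<eta> * g \<eta> = rho n \<eta> powr (b2 + (b2 - \<alpha>2) * (q - 1)) * cmod (rho2 n w0 \<eta>) powr (- c2 + - (c2 * (q - 1))) * indicator (A N) \<eta>"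
          unfolding g_def powr_add by simp
        also have "- c2 + - (c2 * (q - 1)) = - (c2 * q)" by (simp add: algebra_simps)
        finally show ?thesis by (simp add: B k_def)
      qed
      have g2: "rho n \<eta> powr \<alpha>2 * g \<eta> powr p2 = k \<eta> * indicator (A N) \<eta>" if "\<eta> \<in> TB n" for \<eta>
      proof -
        have "rho n \<eta> > 0" "cmod (rho2 n w0 \<eta>) > 0"
          using TB_D(2)[OF that] rho2_nonzero[OF TB_D(2)[OF w0] TB_D(2)[OF that]] by auto
        then have "rho n \<eta> powr \<alpha>2 * g \<eta> powr p2 = rho n \<eta> powr (\<alpha>2 + (b2 - \<alpha>2) * ((q - 1) * p2)) * cmod (rho2 n w0 \<eta>) powr (- (c2 * ((q - 1) * p2))) * indicator (A N) \<eta>"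
          unfolding g_def powr_add using p by (auto simp: powr_mult powr_powr indicator_def mult.assoc)
        then show ?thesis unfolding q(2) B(2) by (simp add: k_def)
      qed
      have "(\<integral>\<^sup>+\<eta>. ennreal (g \<eta> powr p2) \<partial>dV n \<alpha>2) = (\<integral>\<^sup>+\<eta>. ennreal (rho n \<eta> powr \<alpha>2) * ennreal (g \<eta> powr p2) \<partial>dV n 0)"
        by (rule nn_integral_dV) measurable
      also have "\<dots> = (\<integral>\<^sup>+\<eta>. ennreal (k \<eta> * indicator (A N) \<eta>) \<partial>dV n 0)"
        by (intro nn_integral_cong_AE) (simp add: AE_dV_iff g2 flip: ennreal_mult)
      finally have norm_g: "(\<integral>\<^sup>+\<eta>. ennreal (g \<eta> powr p2) \<partial>dV n \<alpha>2) = ennreal (x N)" by (simp add: x_int)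
      have "(\<integral>\<^sup>+\<eta>. ennreal (weight b2 c2 w0 \<eta> * g \<eta>) \<partial>dV n 0) = (\<integral>\<^sup>+\<eta>. ennreal (k \<eta> * indicator (A N) \<eta>) \<partial>dV n 0)"
        by (intro nn_integral_cong_AE) (simp add: AE_dV_iff g1)
      then have pair_g: "(\<integral>\<^sup>+\<eta>. ennreal (weight b2 c2 w0 \<eta> * g \<eta>) \<partial>dV n 0) = ennreal (x N)" by (simp add: x_int)
      have "ennreal (rho n z0 powr a1 * rho n w0 powr a2) * (forelli_rudin n b1 c1 z0 * (\<integral>\<^sup>+\<eta>. ennreal (weight b2 c2 w0 \<eta> * g \<eta>) \<partial>dV n 0))
        \<le> ennreal (C * x N powr (1 / p2))"
        by (rule test[rule_format, OF z0 w0 _ _ _ norm_g]) (auto simp: g_def x_def)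
      then show ?thesis unfolding pair_g .
    qed
    with sup show ?thesis by (intro exI[of _ x]) (auto simp: x_def)
  qed
  obtain e where e: "e \<in> TB n" "rho n e = 1" using TB_rho_exists[OF zero_less_one] by blast
  \<comment> \<open>With w0 = \<open>e\<close> and one N for which \<open>x N\<close> is positive
    and finite, division by \<open>x N\<close> leaves a bound uniform in z0. Such an N exists
    because the supremum is positive.\<close>
  have first: "a1 > 0 \<and> b1 > -1 \<and> c1 = real n + 1 + a1 + b1"
  proof -
    obtain x :: "nat \<Rightarrow> real" where x: "\<And>N. x N \<ge> 0" "(SUP N. ennreal (x N)) = forelli_rudin n B (c2 * q) e"
      "\<And>N z0. z0 \<in> TB n \<Longrightarrow> ennreal (rho n z0 powr a1 * rho n e powr a2) * (forelli_rudin n b1 c1 z0 * ennreal (x N))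
        \<le> ennreal (C * x N powr (1 / p2))"
      using dual[OF e(1)] by blast
    have "0 < forelli_rudin n B (c2 * q) e"
      using e forelli_rudin_const_pos[of n B "c2 * q"] by (simp add: forelli_rudin_eq)
    then obtain N where "0 < ennreal (x N)"
      unfolding x(2)[symmetric] by (auto simp: less_SUP_iff)
    then have N: "x N > 0" by simp
    have "ennreal (rho n z powr a1) * forelli_rudin n b1 c1 z \<le> ennreal (C * x N powr (1 / p2) * (1 / x N))" if z: "z \<in> TB n" for z
    proof -
      have "ennreal (rho n z powr a1) * forelli_rudin n b1 c1 z
          = (ennreal (rho n z powr a1) * forelli_rudin n b1 c1 z) * ennreal (x N * (1 / x N))"
        using N by simp
      also have "\<dots> = (ennreal (rho n z powr a1 * rho n e powr a2) * (forelli_rudin n b1 c1 z * ennreal (x N))) * ennreal (1 / x N)"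
        using N e by (subst ennreal_mult) (simp_all add: mult_ac)
      also have "\<dots> \<le> ennreal (C * x N powr (1 / p2)) * ennreal (1 / x N)"
        by (intro mult_right_mono x(3) z) simp
      finally show ?thesis using C N by (subst ennreal_mult[of "C * x N powr (1 / p2)" "1 / x N"]) auto
    qed
    then show ?thesis
      by (intro bounded_forelli_rudin[of "ennreal (C * x N powr (1 / p2) * (1 / x N))"]) auto
  qed
  then have "forelli_rudin_const n b1 c1 < \<infinity>"
    using forelli_rudin_const_finite[OF n, of b1 c1] by simp
  then obtain \<kappa> where \<kappa>: "forelli_rudin_const n b1 c1 = ennreal \<kappa>" "\<kappa> > 0"
    using forelli_rudin_const_pos[of n b1 c1] by (cases "forelli_rudin_const n b1 c1") auto
  \<comment> \<open>Now z0 = \<open>e\<close> is fixed; its factor \<kappa> is finite by the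
    conditions just proved. Dividing by \<kappa> x^(1/p2) leaves x^(1/q), and the q-th power
    together with the supremum over N gives a bound for the exponents a2 q, B and c2 q.\<close>
  have "a2 * q > 0 \<and> B > -1 \<and> c2 * q = real n + 1 + a2 * q + B"
  proof (rule bounded_forelli_rudin)
    fix w assume w: "w \<in> TB n"
    obtain x :: "nat \<Rightarrow> real" where x: "\<And>N. x N \<ge> 0" "(SUP N. ennreal (x N)) = forelli_rudin n B (c2 * q) w"
      "\<And>N z0. z0 \<in> TB n \<Longrightarrow> ennreal (rho n z0 powr a1 * rho n w powr a2) * (forelli_rudin n b1 c1 z0 * ennreal (x N))
        \<le> ennreal (C * x N powr (1 / p2))"
      using dual[OF w] by blast
    have bd: "rho n w powr (a2 * q) * x N \<le> (C / \<kappa>) powr q" for N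
    proof (cases "x N = 0")
      case False
      then have xN: "x N > 0" using x(1)[of N] by simp
      have "ennreal (rho n w powr a2) * (ennreal \<kappa> * ennreal (x N)) \<le> ennreal (C * x N powr (1 / p2))"
        using x(3)[OF e(1), of N] e by (simp add: forelli_rudin_eq \<kappa>)
      then have "rho n w powr a2 * (\<kappa> * x N) \<le> C * x N powr (1 / p2)"
        using \<kappa> xN C by (simp add: ennreal_mult[symmetric])
      moreover have "x N = x N powr (1 / q) * x N powr (1 / p2)"
        using xN unfolding q(3)[symmetric] by (simp flip: powr_add)
      ultimately have "(rho n w powr a2 * \<kappa> * x N powr (1 / q)) * x N powr (1 / p2) \<le> C * x N powr (1 / p2)"
        by (simp add: mult_ac)
      then have "rho n w powr a2 * \<kappa> * x N powr (1 / q) \<le> C" using xN by simp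
      then have "rho n w powr a2 * x N powr (1 / q) \<le> C / \<kappa>" using \<kappa> by (simp add: field_simps)
      then have "(rho n w powr a2 * x N powr (1 / q)) powr q \<le> (C / \<kappa>) powr q"
        using q by (intro powr_mono2) auto
      then show ?thesis using q xN by (simp add: powr_mult powr_powr)
    qed simp
    have "ennreal (rho n w powr (a2 * q)) * forelli_rudin n B (c2 * q) w
        = (SUP N. ennreal (rho n w powr (a2 * q)) * ennreal (x N))"
      unfolding x(2)[symmetric] by (rule SUP_mult_left_ennreal)
    also have "\<dots> \<le> ennreal ((C / \<kappa>) powr q)"
      using bd x(1) by (intro SUP_least) (simp flip: ennreal_mult)
    finally show "ennreal (rho n w powr (a2 * q)) * forelli_rudin n B (c2 * q) w \<le> ennreal ((C / \<kappa>) powr q)" .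
  qed simp
  then have second: "a2 > 0" "B > -1" "c2 * q = real n + 1 + a2 * q + B"
    using q(1) by (auto simp: zero_less_mult_iff)
  have "c2 * q = (real n + 1 + a2 + b2 - (real n + 1 + \<alpha>2) / p2) * q"
    using second(3) conj(7)[of "real n + 1" a2] by simp
  then have "c2 = real n + 1 + a2 + b2 - (real n + 1 + \<alpha>2) / p2" using q(1) by simp
  moreover have "p2 * (b2 + 1) > \<alpha>2 + 1" using second(2) conj(6) by blast
  ultimately show ?thesis using first second by blast
qed

text \<open>Replacing |f(u,\<eta>)| by its essential supremum G(\<eta>) in u separates the
  variables. The u-integral is \<open>\<kappa>1\<close> times \<rho>(z)^(-a1). After normalization,
  Young's inequality bounds the \<eta>-integral by 1 + \<open>\<kappa>2\<close>, which is the origin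
  of the operator constant.\<close>

lemma parameters_imp_bounded:
  assumes p: "p2 > 1" and a: "a1 > 0" "a2 > 0" and b: "b1 > -1" "p2 * (b2 + 1) > \<alpha>2 + 1"
    and c: "c1 = real n + 1 + a1 + b1" "c2 = real n + 1 + a2 + b2 - (real n + 1 + \<alpha>2) / p2"
  shows "bounded_inf_p_to_inf n p2 \<alpha>1 \<alpha>2 a1 a2 K"
proof -
  let ?MM = "dV n 0 \<Otimes>\<^sub>M dV n 0"
  define q where "q = p2 / (p2 - 1)"
  define B where "B = (b2 - \<alpha>2 / p2) * q"
  note conj = conjugate_exponent[OF p q_def B_def]
  have q: "q > 0" and B: "B > -1" using conj(1,6) b(2) by auto
  have c2q: "c2 * q = real n + 1 + a2 * q + B"
    unfolding c using conj(7)[of "real n + 1" a2] by simp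
  have "forelli_rudin_const n b1 c1 < \<infinity>"
    using forelli_rudin_const_finite[OF n, of b1 c1] a b c by simp
  then obtain \<kappa>1 where \<kappa>1: "forelli_rudin_const n b1 c1 = ennreal \<kappa>1" "\<kappa>1 \<ge> 0"
    by (cases "forelli_rudin_const n b1 c1") auto
  have "forelli_rudin_const n B (c2 * q) < \<infinity>"
    using forelli_rudin_const_finite[OF n, of B "c2 * q"] a B c2q q by simp
  then obtain \<kappa>2 where \<kappa>2: "forelli_rudin_const n B (c2 * q) = ennreal \<kappa>2" "\<kappa>2 \<ge> 0"
    by (cases "forelli_rudin_const n B (c2 * q)") auto
  have FR1: "forelli_rudin n b1 c1 z = ennreal (rho n z powr (- a1) * \<kappa>1)" if "z \<in> TB n" for z
    using TB_D(2)[OF that] \<kappa>1 by (simp add: forelli_rudin_eq c ennreal_mult)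
  have FR2: "forelli_rudin n B (c2 * q) w = ennreal (rho n w powr (- (a2 * q)) * \<kappa>2)" if "w \<in> TB n" for w
    using TB_D(2)[OF that] \<kappa>2 by (simp add: forelli_rudin_eq c2q ennreal_mult)
  \<comment> \<open>\<open>N\<close> is a positive upper bound rather than the norm itself: the
    argument divides by \<open>N\<close>, and the norm can be 0.\<close>
  have abs_bound: "(\<integral>\<^sup>+y. ennreal (cmod (K z w (fst y) (snd y) * f y)) \<partial>?MM)
      \<le> ennreal (rho n z powr (- a1) * \<kappa>1 * (N * rho n w powr (- a2) * (1 + \<kappa>2)))"
    if z: "z \<in> TB n" and w: "w \<in> TB n" and f[measurable]: "f \<in> borel_measurable (Cn n \<Otimes>\<^sub>M Cn n)"
      and N: "N > 0" "mixed_norm_inf_p n p2 \<alpha>1 \<alpha>2 f \<le> ennreal N" for z w f N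
  proof -
    note [measurable] = TB_D(1)[OF z] TB_D(1)[OF w]
    have rz: "rho n z > 0" and rw: "rho n w > 0" using TB_D(2) z w by auto
    define G where "G \<eta> = esssup (dV n \<alpha>1) (\<lambda>u. ennreal (cmod (f (u, \<eta>))))" for \<eta>
    have G[measurable]: "G \<in> borel_measurable (Cn n)"
    proof -
      have "(\<lambda>x. ennreal (cmod (f x))) \<in> borel_measurable (dV n \<alpha>1 \<Otimes>\<^sub>M Cn n)" by measurable
      from borel_measurable_esssup[OF sigma_finite_dV this] show ?thesis by (simp add: G_def[abs_def])
    qed
    have f_le_G: "AE u in dV n 0. ennreal (cmod (f (u, \<eta>))) \<le> G \<eta>" for \<eta>
      using esssup_AE[of "\<lambda>u. ennreal (cmod (f (u, \<eta>)))" "dV n \<alpha>1"] unfolding AE_dV_iff G_def .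
    note K_section_measurable[OF TB_D(1)[OF z] TB_D(1)[OF w], measurable]
    have "(\<integral>\<^sup>+y. ennreal (cmod (K z w (fst y) (snd y) * f y)) \<partial>?MM)
       = (\<integral>\<^sup>+\<eta>. \<integral>\<^sup>+u. ennreal (cmod (K z w u \<eta> * f (u, \<eta>))) \<partial>dV n 0 \<partial>dV n 0)"
      by (subst dV0.nn_integral_snd[symmetric]) auto
    also have "\<dots> \<le> (\<integral>\<^sup>+\<eta>. \<integral>\<^sup>+u. ennreal (weight b1 c1 z u) * (ennreal (weight b2 c2 w \<eta>) * G \<eta>) \<partial>dV n 0 \<partial>dV n 0)"
    proof (rule nn_integral_mono, rule nn_integral_mono_AE)
      fix \<eta>
      from f_le_G[of \<eta>] show "AE u in dV n 0. ennreal (cmod (K z w u \<eta> * f (u, \<eta>))) \<le> ennreal (weight b1 c1 z u) * (ennreal (weight b2 c2 w \<eta>) * G \<eta>)"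
      proof eventually_elim
        case (elim u)
        have "ennreal (cmod (K z w u \<eta> * f (u, \<eta>))) = ennreal (weight b1 c1 z u) * (ennreal (weight b2 c2 w \<eta>) * ennreal (cmod (f (u, \<eta>))))"
          by (simp add: norm_mult norm_K ennreal_mult mult_ac)
        also have "\<dots> \<le> ennreal (weight b1 c1 z u) * (ennreal (weight b2 c2 w \<eta>) * G \<eta>)"
          by (intro mult_left_mono elim) auto
        finally show ?case .
      qed
    qed
    also have "\<dots> = (\<integral>\<^sup>+x. ennreal (weight b1 c1 z (fst x)) * (ennreal (weight b2 c2 w (snd x)) * G (snd x)) \<partial>?MM)"
      by (subst dV0.nn_integral_snd[symmetric]) auto
    also have "\<dots> = forelli_rudin n b1 c1 z * (\<integral>\<^sup>+\<eta>. ennreal (weight b2 c2 w \<eta>) * G \<eta> \<partial>dV n 0)"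
      by (rule nn_integral_weight_product) measurable
    also have "(\<integral>\<^sup>+\<eta>. ennreal (weight b2 c2 w \<eta>) * G \<eta> \<partial>dV n 0) \<le> ennreal (N * rho n w powr (- a2) * (1 + \<kappa>2))"
    proof -
      define I where "I = (\<integral>\<^sup>+\<eta>. enn_powr (G \<eta>) p2 \<partial>dV n \<alpha>2)"
      have I: "I \<le> ennreal (N powr p2)"
      proof -
        have I_N: "enn_powr I (1 / p2) \<le> ennreal N" using N(2) by (simp add: mixed_norm_inf_p_def I_def G_def)
        then obtain i where i: "I = ennreal i" "i \<ge> 0"
          by (cases I) (auto simp: enn_powr_def top_unique)
        then have "i powr (1 / p2) \<le> N" using I_N N(1) by (simp add: enn_powr_ennreal)
        then have "(i powr (1 / p2)) powr p2 \<le> N powr p2" using p by (intro powr_mono2) auto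
        then show ?thesis using i p by (simp add: powr_powr)
      qed
      let ?c = "N * rho n w powr (- a2)"
      have pointwise: "ennreal (weight b2 c2 w \<eta>) * G \<eta>
         \<le> ennreal ?c * (ennreal (N powr (- p2)) * (ennreal (rho n \<eta> powr \<alpha>2) * enn_powr (G \<eta>) p2)
            + ennreal (rho n w powr (a2 * q)) * ennreal (weight B (c2 * q) w \<eta>))" if \<eta>: "\<eta> \<in> TB n" for \<eta>
      proof (cases "G \<eta>")
        case (real t)
        have r: "rho n \<eta> > 0" using TB_D(2)[OF \<eta>] .
        have m: "cmod (rho2 n w \<eta>) > 0" using rho2_nonzero[OF rw r] by simp
        \<comment> \<open>The normalization is such that X^p2 has integral at most 1 and Y^q has
          integral \<open>\<kappa>2\<close>, both independently of f and w. The product of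
          \<open>X\<close> and \<open>Y\<close> gives back the integrand up to the factor
          \<open>?c\<close>.\<close>
        define X where "X = t * rho n \<eta> powr (\<alpha>2 / p2) / N"
        define Y where "Y = weight (b2 - \<alpha>2 / p2) c2 w \<eta> * rho n w powr a2"
        have "weight b2 c2 w \<eta> * t = ?c * (X * Y)"
          using N r rw by (simp add: X_def Y_def powr_diff powr_minus_divide)
        also have "\<dots> \<le> ?c * (X powr p2 + Y powr q)"
          using N p real(1) by (intro mult_left_mono young_crude) (auto simp: X_def Y_def q_def)
        also have "X powr p2 = N powr (- p2) * (rho n \<eta> powr \<alpha>2 * t powr p2)"
          using N p r real(1) by (simp add: X_def powr_mult powr_divide powr_powr powr_minus_divide)
        also have "Y powr q = rho n w powr (a2 * q) * weight B (c2 * q) w \<eta>"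
          by (simp add: Y_def powr_mult powr_powr B_def)
        finally have "ennreal (weight b2 c2 w \<eta> * t) \<le> ennreal (?c * (N powr (- p2) * (rho n \<eta> powr \<alpha>2 * t powr p2) + rho n w powr (a2 * q) * weight B (c2 * q) w \<eta>))"
          by (rule ennreal_leI)
        then show ?thesis
          using real N by (simp add: enn_powr_ennreal ennreal_mult ennreal_plus)
      next
        \<comment> \<open>For infinite G the right side is infinite as well, because the
          coefficients in front of it are positive on the tube.\<close>
        case top
        have "rho n \<eta> > 0" using TB_D(2)[OF \<eta>] .
        then show ?thesis using N rw
          by (simp add: top enn_powr_def ennreal_mult_top ennreal_top_mult)
      qed
      have "(\<integral>\<^sup>+\<eta>. ennreal (weight b2 c2 w \<eta>) * G \<eta> \<partial>dV n 0)
        \<le> (\<integral>\<^sup>+\<eta>. ennreal ?c * (ennreal (N powr (- p2)) * (ennreal (rho n \<eta> powr \<alpha>2) * enn_powr (G \<eta>) p2)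
            + ennreal (rho n w powr (a2 * q)) * ennreal (weight B (c2 * q) w \<eta>)) \<partial>dV n 0)"
        by (intro nn_integral_mono_AE) (simp add: AE_dV_iff pointwise)
      also have "\<dots> = ennreal ?c * (ennreal (N powr (- p2)) * I + ennreal (rho n w powr (a2 * q)) * forelli_rudin n B (c2 * q) w)"
      proof -
        have "I = (\<integral>\<^sup>+\<eta>. ennreal (rho n \<eta> powr \<alpha>2) * enn_powr (G \<eta>) p2 \<partial>dV n 0)"
          unfolding I_def by (rule nn_integral_dV) measurable
        then show ?thesis
          by (subst nn_integral_cmult, measurable, subst nn_integral_add, measurable)
             (simp add: nn_integral_cmult forelli_rudin_def)
      qed
      also have "\<dots> \<le> ennreal ?c * (ennreal (N powr (- p2)) * ennreal (N powr p2) + ennreal (rho n w powr (a2 * q)) * ennreal (rho n w powr (- (a2 * q)) * \<kappa>2))"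
        unfolding FR2[OF w] by (intro mult_left_mono add_mono I) auto
      also have "ennreal (N powr (- p2)) * ennreal (N powr p2) = 1"
        using N by (simp flip: ennreal_mult powr_add)
      also have "ennreal (rho n w powr (a2 * q)) * ennreal (rho n w powr (- (a2 * q)) * \<kappa>2) = ennreal \<kappa>2"
        using rw \<kappa>2 by (simp add: ennreal_mult[symmetric] mult.assoc[symmetric] flip: powr_add)
      also have "ennreal ?c * (1 + ennreal \<kappa>2) = ennreal (?c * (1 + \<kappa>2))"
        using N \<kappa>2 by (simp add: ennreal_mult)
      finally show ?thesis .
    qed
    finally show ?thesis
      unfolding FR1[OF z] using \<kappa>1 \<kappa>2 N by (simp add: ennreal_mult mult_left_mono)
  qed
  show ?thesis
    unfolding bounded_inf_p_to_inf_def
  proof (intro exI[of _ "\<kappa>1 * (1 + \<kappa>2)"] conjI ballI impI)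
    show "\<kappa>1 * (1 + \<kappa>2) \<ge> 0" using \<kappa>1 \<kappa>2 by simp
    fix f assume f[measurable]: "f \<in> borel_measurable (Cn n \<Otimes>\<^sub>M Cn n)" and fin: "mixed_norm_inf_p n p2 \<alpha>1 \<alpha>2 f < \<infinity>"
    obtain N where N: "mixed_norm_inf_p n p2 \<alpha>1 \<alpha>2 f = ennreal N" "N \<ge> 0"
      using fin by (cases "mixed_norm_inf_p n p2 \<alpha>1 \<alpha>2 f") auto
    have int: "integrable ?MM (\<lambda>y. K z w (fst y) (snd y) * f y)" if "z \<in> TB n" "w \<in> TB n" for z w
    proof (rule integrableI_bounded)
      note K_section_measurable[OF TB_D(1)[OF that(1)] TB_D(1)[OF that(2)], measurable]
      show "(\<lambda>y. K z w (fst y) (snd y) * f y) \<in> borel_measurable ?MM" by measurable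
      show "(\<integral>\<^sup>+y. ennreal (cmod (K z w (fst y) (snd y) * f y)) \<partial>?MM) < \<infinity>"
        using abs_bound[OF that f, of "N + 1"] N by (auto intro: order.strict_trans1 simp: ennreal_leI)
    qed
    show "AE x in ?MM. integrable ?MM (\<lambda>(u, \<eta>). K (fst x) (snd x) u \<eta> * f (u, \<eta>))"
      using AE_dV0_pair by eventually_elim (use int in \<open>simp add: case_prod_beta'\<close>)
    have "cmod (op_int n a1 a2 K f (z, w)) \<le> \<kappa>1 * (1 + \<kappa>2) * N" if z: "z \<in> TB n" and w: "w \<in> TB n" for z w
    \<comment> \<open>Since the norm \<open>N\<close> may vanish, \<open>abs_bound\<close> is
      applied with \<open>N + d\<close>, and d is chosen so small that the excess is at most
      e.\<close>
    proof (rule field_le_epsilon)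
      fix e :: real assume "e > 0"
      have k: "\<kappa>1 * (1 + \<kappa>2) \<ge> 0" using \<kappa>1 \<kappa>2 by simp
      define d where "d = e / (\<kappa>1 * (1 + \<kappa>2) + 1)"
      have d: "d > 0" "\<kappa>1 * (1 + \<kappa>2) * d \<le> e"
        using \<open>e > 0\<close> k by (auto simp: d_def field_simps)
      have rz: "rho n z > 0" and rw: "rho n w > 0" using TB_D(2) z w by auto
      have "ennreal (cmod (\<integral>y. K z w (fst y) (snd y) * f y \<partial>?MM)) \<le> (\<integral>\<^sup>+y. ennreal (cmod (K z w (fst y) (snd y) * f y)) \<partial>?MM)"
        by (rule integral_norm_bound_ennreal[OF int[OF z w]])
      also have "\<dots> \<le> ennreal (rho n z powr (- a1) * \<kappa>1 * ((N + d) * rho n w powr (- a2) * (1 + \<kappa>2)))"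
        using N d by (intro abs_bound z w f) (auto intro: ennreal_leI)
      finally have le: "cmod (\<integral>y. K z w (fst y) (snd y) * f y \<partial>?MM) \<le> rho n z powr (- a1) * \<kappa>1 * ((N + d) * rho n w powr (- a2) * (1 + \<kappa>2))"
        using N d \<kappa>1 \<kappa>2 by (subst (asm) ennreal_le_iff) auto
      have "cmod (op_int n a1 a2 K f (z, w)) = rho n z powr a1 * rho n w powr a2 * cmod (\<integral>y. K z w (fst y) (snd y) * f y \<partial>?MM)"
        by (simp add: op_int_def norm_mult case_prod_beta')
      also have "\<dots> \<le> rho n z powr a1 * rho n w powr a2 * (rho n z powr (- a1) * \<kappa>1 * ((N + d) * rho n w powr (- a2) * (1 + \<kappa>2)))"
        by (intro mult_left_mono le) simp
      also have "\<dots> = \<kappa>1 * (1 + \<kappa>2) * (N + d)"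
        using rz rw by (simp add: powr_minus_divide)
      also have "\<dots> \<le> \<kappa>1 * (1 + \<kappa>2) * N + e" using d by (simp add: algebra_simps)
      finally show "cmod (op_int n a1 a2 K f (z, w)) \<le> \<kappa>1 * (1 + \<kappa>2) * N + e" .
    qed
    then have "mixed_norm_inf_inf n (op_int n a1 a2 K f) \<le> ennreal (\<kappa>1 * (1 + \<kappa>2) * N)"
      by (intro mixed_norm_inf_inf_le op_int_measurable f ennreal_leI)
    then show "mixed_norm_inf_inf n (op_int n a1 a2 K f) \<le> ennreal (\<kappa>1 * (1 + \<kappa>2)) * mixed_norm_inf_p n p2 \<alpha>1 \<alpha>2 f"
      using N \<kappa>1 \<kappa>2 by (simp add: ennreal_mult)
  qed
qed

lemma bounded_iff_parameters:
  assumes "p2 > 1"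
  shows "bounded_inf_p_to_inf n p2 \<alpha>1 \<alpha>2 a1 a2 K \<longleftrightarrow>
    a1 > 0 \<and> a2 > 0 \<and> b1 > -1 \<and> p2 * (b2 + 1) > \<alpha>2 + 1
     \<and> c1 = real n + 1 + a1 + b1 \<and> c2 = real n + 1 + a2 + b2 - (real n + 1 + \<alpha>2) / p2"
  using bounded_imp_parameters[OF assms] parameters_imp_bounded[OF assms] by blast

end

section \<open>The kernels of T and S as instances\<close>

context tube begin

lemma cmod_kerT: "cmod (kerT n b1 b2 c1 c2 z w u \<eta>) = weight b1 c1 z u * weight b2 c2 w \<eta>"
  by (simp add: kerT_def norm_divide norm_mult norm_powr_real_powr' powr_minus_divide)

lemma kerS_eq_cmod_kerT: "kerS n b1 b2 c1 c2 z w u \<eta> = complex_of_real (cmod (kerT n b1 b2 c1 c2 z w u \<eta>))"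
  by (simp add: cmod_kerT kerS_def powr_minus_divide)

lemma kerT_measurable: "(\<lambda>x. kerT n b1 b2 c1 c2 (fst (fst x)) (snd (fst x)) (fst (snd x)) (snd (snd x)))
      \<in> borel_measurable ((Cn n \<Otimes>\<^sub>M Cn n) \<Otimes>\<^sub>M (Cn n \<Otimes>\<^sub>M Cn n))"
  \<comment> \<open>Complex \<open>powr\<close> is opened into \<open>exp\<close> and
    \<open>Ln\<close>, since it is discontinuous across the branch cut; the real powers stay
    folded.\<close>
  unfolding kerT_def powr_def[where 'a=complex] by measurable

lemma kernel_kerT: "kernel n (kerT n b1 b2 c1 c2) b1 b2 c1 c2"
proof unfold_locales
  fix z0 w0 assume "rho n z0 > 0" "rho n w0 > 0"
  then show "\<exists>\<delta>>0. \<forall>z w u \<eta>. near \<delta> z0 z \<longrightarrow> near \<delta> w0 w \<longrightarrow> rho n u > 0 \<longrightarrow> rho n \<eta> > 0 \<longrightarrow>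
        (\<exists>s. kerT n b1 b2 c1 c2 z w u \<eta> = s * kerT n b1 b2 c1 c2 z0 w0 u \<eta> \<and> Re s \<ge> 1/4)"
    using kerT_close[of z0 w0 b1 b2 c1 c2] by metis
qed (use kerT_measurable cmod_kerT in auto)

lemma kernel_kerS: "kernel n (kerS n b1 b2 c1 c2) b1 b2 c1 c2"
proof unfold_locales
  note kerT_measurable[measurable]
  show "(\<lambda>x. kerS n b1 b2 c1 c2 (fst (fst x)) (snd (fst x)) (fst (snd x)) (snd (snd x)))
      \<in> borel_measurable ((Cn n \<Otimes>\<^sub>M Cn n) \<Otimes>\<^sub>M (Cn n \<Otimes>\<^sub>M Cn n))"
    unfolding kerS_eq_cmod_kerT by measurable
  show "cmod (kerS n b1 b2 c1 c2 z w u \<eta>) = weight b1 c1 z u * weight b2 c2 w \<eta>" for z w u \<eta>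
    unfolding kerS_eq_cmod_kerT by (simp only: norm_of_real abs_norm_cancel) (rule cmod_kerT)
  fix z0 w0 assume "rho n z0 > 0" "rho n w0 > 0"
  then obtain \<delta> where \<delta>: "\<delta> > 0" "\<And>z w u \<eta>. near \<delta> z0 z \<Longrightarrow> near \<delta> w0 w \<Longrightarrow> rho n u > 0 \<Longrightarrow> rho n \<eta> > 0 \<Longrightarrow>
      \<exists>s. kerT n b1 b2 c1 c2 z w u \<eta> = s * kerT n b1 b2 c1 c2 z0 w0 u \<eta> \<and> Re s \<ge> 1/4"
    using kerT_close[of z0 w0 b1 b2 c1 c2] by metis
  have "\<exists>s. kerS n b1 b2 c1 c2 z w u \<eta> = s * kerS n b1 b2 c1 c2 z0 w0 u \<eta> \<and> Re s \<ge> 1/4"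
    if near: "near \<delta> z0 z" "near \<delta> w0 w" "rho n u > 0" "rho n \<eta> > 0" for z w u \<eta>
  proof -
    obtain s where s: "kerT n b1 b2 c1 c2 z w u \<eta> = s * kerT n b1 b2 c1 c2 z0 w0 u \<eta>" "Re s \<ge> 1/4"
      using \<delta>(2)[OF near] by blast
    then show ?thesis
      unfolding kerS_eq_cmod_kerT using complex_Re_le_cmod[of s]
      \<comment> \<open>The ratio of the moduli is |s|, and |s| \<ge> Re s \<ge> 1/4, so the control
        obtained for \<open>kerT\<close> transfers to \<open>kerS\<close>.\<close>
      by (intro exI[of _ "complex_of_real (cmod s)"]) (auto simp: norm_mult)
  qed
  with \<delta>(1) show "\<exists>\<delta>>0. \<forall>z w u \<eta>. near \<delta> z0 z \<longrightarrow> near \<delta> w0 w \<longrightarrow> rho n u > 0 \<longrightarrow> rho n \<eta> > 0 \<longrightarrow>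
        (\<exists>s. kerS n b1 b2 c1 c2 z w u \<eta> = s * kerS n b1 b2 c1 c2 z0 w0 u \<eta> \<and> Re s \<ge> 1/4)"
    by blast
qed

end

theorem theorem6p12:
  fixes n :: nat and p2 \<alpha>1 \<alpha>2 a1 a2 b1 b2 c1 c2 :: real
  assumes "n \<ge> 1"
    and "1 < p2"
    and "\<alpha>1 > -1" and "\<alpha>2 > -1"
  shows "(bounded_inf_p_to_inf n p2 \<alpha>1 \<alpha>2 a1 a2 (kerS n b1 b2 c1 c2)
            \<longleftrightarrow> bounded_inf_p_to_inf n p2 \<alpha>1 \<alpha>2 a1 a2 (kerT n b1 b2 c1 c2))
       \<and> (bounded_inf_p_to_inf n p2 \<alpha>1 \<alpha>2 a1 a2 (kerT n b1 b2 c1 c2)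
            \<longleftrightarrow> (a1 > 0 \<and> a2 > 0 \<and> b1 > -1 \<and> p2 * (b2 + 1) > \<alpha>2 + 1
                 \<and> c1 = real n + 1 + a1 + b1
                 \<and> c2 = real n + 1 + a2 + b2 - (real n + 1 + \<alpha>2) / p2))"
proof -
  interpret tube n using assms(1) by unfold_locales
  show ?thesis
    using kernel.bounded_iff_parameters[OF kernel_kerS assms(2)]
      kernel.bounded_iff_parameters[OF kernel_kerT assms(2)] by simp
qed

end
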